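(* Let $X$ be a Peano continuum without cut points, $G$ a group acting on $X$ by homeomorphisms, and $\mathcal{A}$ a $G$-invariant collection of closed subsets of $X$ such that $(G,\mathcal{A})$ is a local convergence pairing on $X$. Then $G$ acts as a convergence group on $X$.
   Context: A Peano continuum is a compact, connected, locally connected metric space. For a closed set $S\subset X$ and connected sets $B,C\subset X\setminus S$, $S$ separates $B$ from $C$ if $B$ and $C$ lie in different components of $X\setminus S$; $S$ separates a set $Y$ if it separates two points of $Y$. Closed sets $A,B$ cross if either $A\cap B\neq\emptyset$, or $A$ separates $B$ and $B$ separates $A$. A crossing sequence from $A_1$ to $A_n$ is a sequence $A_1,\dots,A_n$ with $A_i$ crossing $A_{i+1}$ for all $1\le i<n$. For a group acting by homeomorphisms on a space $Y$, a sequence $(g_i)$ acts as a convergence sequence on $Y$ if there are $n,p\in Y$ (repeller, attractor; possibly equal) such that for every compact $C\subset Y$ with $n\notin C$, $g_i(C)\to p$ (i.e. for each neighborhood $U$ of $p$, $g_i(C)\subset U$ for all large $i$); the group acts as a convergence group on $Y$ if every sequence of distinct elements has a subsequence acting as a convergence sequence on $Y$. The pair $(G,\mathcal{A})$ is a local convergence pairing on $X$ if: (1) $|A|>2$ for all $A\in\mathcal{A}$; (2) $\mathcal{A}$ is null: for each $\epsilon>0$ only finitely many $A\in\mathcal{A}$ have $\operatorname{diam}(A)>\epsilon$; (3) $\mathcal{A}$ is fine: for any $x,y\in X$ there is a finite $\mathcal{B}\subset\mathcal{A}$ with $\bigcup\mathcal{B}$ separating $x$ from $y$; (4) for each $A\in\mathcal{A}$,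 $\mathrm{Stab}(A)=\{g\in G:g(A)=A\}$ acts as a convergence group on $A$; (5) for any $A,B\in\mathcal{A}$ with $|A\cap B|\le 2$: if $A\cap B=\{c\}$ then for any $b\in B\setminus\{c\}$ there is a finite crossing sequence $A,A_1,\dots,A_n,B$ in $\mathcal{A}$ with $D\cap A_i=\emptyset$ for all $1\le i\le n$, where $D=\{b,c\}$; and if $|A\cap B|\neq 1$ then there is a crossing sequence $A,A_1,\dots,A_n,B$ in $\mathcal{A}$ with $D\cap A_i=\emptyset$ for all $1\le i\le n$, where $D=A\cap B$. *)

theory Defs
  imports "HOL-Analysis.Analysis" "HOL-Algebra.Group"
begin

definition peano_continuum :: "'a::metric_space set \<Rightarrow> bool" where
  "peano_continuum X \<longleftrightarrow> X \<noteq> {} \<and> compact X \<and> connected X \<and> locally connected X"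

definition no_cut_points :: "'a::topological_space set \<Rightarrow> bool" where
  "no_cut_points X \<longleftrightarrow> (\<forall>x\<in>X. connected (X - {x}))"

definition separates :: "'a::topological_space set \<Rightarrow> 'a set \<Rightarrow> 'a set \<Rightarrow> 'a set \<Rightarrow> bool" where
  "separates X S B C \<longleftrightarrow>
     closed S \<and> B \<noteq> {} \<and> C \<noteq> {} \<and> B \<subseteq> X - S \<and> C \<subseteq> X - S \<and>
     connected B \<and> connected C \<and>
     (\<forall>x\<in>B. \<forall>y\<in>C. \<not> connected_component (X - S) x y)"

definition separates_set :: "'a::topological_space set \<Rightarrow> 'a set \<Rightarrow> 'a set \<Rightarrow> bool" where
  "separates_set X S Y \<longleftrightarrow> (\<exists>x\<in>Y. \<exists>y\<in>Y. separates X S {x} {y})"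

definition crosses :: "'a::topological_space set \<Rightarrow> 'a set \<Rightarrow> 'a set \<Rightarrow> bool" where
  "crosses X A B \<longleftrightarrow> A \<inter> B \<noteq> {} \<or> (separates_set X A B \<and> separates_set X B A)"

definition crossing_seq_avoiding ::
  "'a::topological_space set \<Rightarrow> 'a set set \<Rightarrow> 'a set \<Rightarrow> 'a set \<Rightarrow> 'a set \<Rightarrow> bool" where
  "crossing_seq_avoiding X \<A> D A B \<longleftrightarrow>
     (\<exists>As. As \<noteq> [] \<and> set As \<subseteq> \<A> \<and> (\<forall>Ai\<in>set As. D \<inter> Ai = {}) \<and>
        (let L = A # As @ [B] in \<forall>i < length L - 1. crosses X (L ! i) (L ! Suc i)))"

definition homeo_action :: "('g, 'b) monoid_scheme \<Rightarrow> 'a::topological_space set \<Rightarrow> ('g \<Rightarrow> 'a \<Rightarrow> 'a) \<Rightarrow> bool" where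
  "homeo_action G X \<phi> \<longleftrightarrow> group G \<and>
     (\<forall>g\<in>carrier G. homeomorphism X X (\<phi> g) (\<phi> (inv\<^bsub>G\<^esub> g))) \<and>
     (\<forall>x\<in>X. \<phi> \<one>\<^bsub>G\<^esub> x = x) \<and>
     (\<forall>g\<in>carrier G. \<forall>h\<in>carrier G. \<forall>x\<in>X. \<phi> (g \<otimes>\<^bsub>G\<^esub> h) x = \<phi> g (\<phi> h x))"

definition convergence_seq :: "('g \<Rightarrow> 'a \<Rightarrow> 'a) \<Rightarrow> 'a::topological_space set \<Rightarrow> (nat \<Rightarrow> 'g) \<Rightarrow> bool" where
  "convergence_seq \<phi> Y g \<longleftrightarrow>
     (\<exists>n\<in>Y. \<exists>p\<in>Y. \<forall>C. compact C \<and> C \<subseteq> Y \<and> n \<notin> C \<longrightarrow>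
        (\<forall>U. openin (top_of_set Y) U \<and> p \<in> U \<longrightarrow>
           (\<forall>\<^sub>F i in sequentially. \<phi> (g i) ` C \<subseteq> U)))"

definition convergence_group :: "('g \<Rightarrow> 'a \<Rightarrow> 'a) \<Rightarrow> 'g set \<Rightarrow> 'a::topological_space set \<Rightarrow> bool" where
  "convergence_group \<phi> H Y \<longleftrightarrow>
     (\<forall>g::nat \<Rightarrow> 'g. (\<forall>i. g i \<in> H) \<and> inj g \<longrightarrow>
        (\<exists>r. strict_mono r \<and> convergence_seq \<phi> Y (g \<circ> r)))"

definition stab :: "('g, 'b) monoid_scheme \<Rightarrow> ('g \<Rightarrow> 'a \<Rightarrow> 'a) \<Rightarrow> 'a set \<Rightarrow> 'g set" where
  "stab G \<phi> A = {g \<in> carrier G. \<phi> g ` A = A}"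

definition local_convergence_pairing ::
  "('g, 'b) monoid_scheme \<Rightarrow> ('g \<Rightarrow> 'a \<Rightarrow> 'a) \<Rightarrow> 'a set set \<Rightarrow> 'a::metric_space set \<Rightarrow> bool" where
  "local_convergence_pairing G \<phi> \<A> X \<longleftrightarrow>
     (\<forall>A\<in>\<A>. infinite A \<or> card A > 2) \<and>
     (\<forall>e>0. finite {A \<in> \<A>. diameter A > e}) \<and>
     (\<forall>x\<in>X. \<forall>y\<in>X. x \<noteq> y \<longrightarrow>
        (\<exists>\<B>. \<B> \<subseteq> \<A> \<and> finite \<B> \<and> separates X (\<Union>\<B>) {x} {y})) \<and>
     (\<forall>A\<in>\<A>. convergence_group \<phi> (stab G \<phi> A) A) \<and>
     (\<forall>A\<in>\<A>. \<forall>B\<in>\<A>. finite (A \<inter> B) \<and> card (A \<inter> B) \<le> 2 \<longrightarrow>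
        (\<forall>c. A \<inter> B = {c} \<longrightarrow>
           (\<forall>b\<in>B - {c}. crossing_seq_avoiding X \<A> {b, c} A B)) \<and>
        (card (A \<inter> B) \<noteq> 1 \<longrightarrow> crossing_seq_avoiding X \<A> (A \<inter> B) A B))"

end

theory Submission
  imports Defs "HOL-Library.Diagonal_Subsequence"
begin

text \<open>
  Nullness makes \<open>\<A>\<close> countable, so a diagonal subsequence of \<open>(g\<^sub>i)\<close> can be chosen for which every
  \<open>A \<in> \<A>\<close> either shrinks to a point under \<open>g\<^sub>i\<close>, or has eventually constant image \<open>A'\<close> and
  source-sink dynamics \<open>A \<rightarrow> A'\<close> inherited from \<open>Stab(A')\<close>; the same is arranged for \<open>g\<^sub>i\<^sup>-\<^sup>1\<close>.
  Every \<open>A\<close> thus has an attractor. Without cut points a small set cannot separate points that are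
  far from it, so two sets that cross without meeting have the same attractor, and so do two sets that
  meet outside their sources. The only obstruction is a meeting in the sources, and the crossing
  sequences of condition (5) circumvent exactly these points. Hence all attractors equal one point
  \<open>p\<close>, and all attractors of the inverses equal one point \<open>n\<close>, which is therefore the source of
  every non-shrinking \<open>A\<close>. If finitely many members of \<open>\<A>\<close> separate \<open>x\<close> from \<open>n\<close>, they avoid \<open>n\<close>
  and so shrink to \<open>p\<close>; everything away from \<open>p\<close> then lies in one complementary component of their
  images, namely that of the image of the \<open>n\<close>-side, so a neighbourhood of \<open>x\<close> is carried near \<open>p\<close>.
\<close>

section \<open>Small sets in a space without cut points\<close>

lemma openin_Diff_closed: "closed S \<Longrightarrow> openin (top_of_set X) (X - S)"
  unfolding openin_open Diff_eq by (auto intro: open_Compl)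

lemma component_near_point:
  fixes X :: "'a::metric_space set"
  assumes "locally connected X" "closed S" "x \<in> X - S"
  obtains e where "e > 0" "\<And>y. y \<in> X \<Longrightarrow> dist y x < e \<Longrightarrow> connected_component (X - S) x y"
proof -
  have "openin (top_of_set X) (X - S)"
    using assms(2) by (rule openin_Diff_closed)
  then have "openin (top_of_set X) (connected_component_set (X - S) x)"
    using assms locally_connected_open_connected_component by blast
  moreover have "x \<in> connected_component_set (X - S) x"
    using assms(3) by auto
  ultimately obtain e where "e > 0" "\<forall>y\<in>X. dist y x < e \<longrightarrow> y \<in> connected_component_set (X - S) x"
    unfolding openin_euclidean_subtopology_iff by blast
  then show ?thesis by (intro that[of e]) auto
qed

text \<open>Since \<open>p\<close> is no cut point, any two points of the connected set
  \<open>X - {p}\<close> are joined outside some closed ball about \<open>p\<close>. Compactness of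
  \<open>X - ball p e\<close> makes one radius serve for all far points.\<close>

lemma small_set_not_separating:
  fixes X :: "'a::metric_space set"
  assumes X: "compact X" "locally connected X" "no_cut_points X" and "p \<in> X" "e > 0"
  obtains d where "d > 0"
    "\<And>S x y. S \<subseteq> ball p d \<Longrightarrow> x \<in> X - ball p e \<Longrightarrow> y \<in> X - ball p e
       \<Longrightarrow> connected_component (X - S) x y"
proof (cases "X - ball p e = {}")
  case True
  show ?thesis
    by (rule that[of 1]) (use True in auto)
next
  case False
  then obtain x0 where x0: "x0 \<in> X - ball p e" by blast
  \<comment> \<open>Closed balls leave an open complement, so each \<open>W k\<close> is open in
    \<open>X\<close> (and empty if \<open>x0\<close> lies in the ball). These sets increase with
    \<open>k\<close> and together cover \<open>X - {p}\<close>.\<close>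
  define W where "W k = connected_component_set (X - cball p (inverse (Suc k))) x0" for k :: nat
  have mono: "connected_component (X - cball p (inverse (Suc l))) x y"
    if "connected_component (X - cball p (inverse (Suc k))) x y" "k \<le> l" for k l x y
  proof (rule connected_component_of_subset[OF that(1)])
    have "inverse (real (Suc l)) \<le> inverse (real (Suc k))"
      using that(2) by simp
    then have "cball p (inverse (Suc l)) \<subseteq> cball p (inverse (Suc k))"
      using subset_cball by blast
    then show "X - cball p (inverse (Suc k)) \<subseteq> X - cball p (inverse (Suc l))" by blast
  qed
  define R where "R x y \<longleftrightarrow> (\<exists>k. connected_component (X - cball p (inverse (Suc k))) x y)" for x y
  \<comment> \<open>\<open>R\<close> is an equivalence relation on \<open>X - {p}\<close> with open
    classes, so connectedness leaves a single class.\<close>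
  have Rx0: "R x0 y" if "y \<in> X - {p}" for y
  proof (rule connected_equivalence_relation[where S = "X - {p}" and R = R])
    show "connected (X - {p})"
      using X(3) \<open>p \<in> X\<close> by (simp add: no_cut_points_def)
    show "x0 \<in> X - {p}" using x0 \<open>e > 0\<close> by auto
    show "y \<in> X - {p}" by fact
    show "R b a" if "R a b" for a b
      using that connected_component_sym unfolding R_def by blast
    show "R a c" if R_ab_bc: "R a b" "R b c" for a b c
    proof -
      obtain k l where kl: "connected_component (X - cball p (inverse (Suc k))) a b"
        "connected_component (X - cball p (inverse (Suc l))) b c"
        using R_ab_bc unfolding R_def by blast
      have "connected_component (X - cball p (inverse (Suc (max k l)))) a c"
        using mono[OF kl(1), of "max k l"] mono[OF kl(2), of "max k l"] connected_component_trans
        by (metis max.cobounded1 max.cobounded2)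
      then show ?thesis unfolding R_def by blast
    qed
    fix a assume a: "a \<in> X - {p}"
    then have "dist p a > 0" by auto
    then obtain k where k: "inverse (real (Suc k)) < dist p a"
      using reals_Archimedean by blast
    then have "a \<in> X - cball p (inverse (Suc k))" using a by auto
    then obtain r where r: "r > 0"
      "\<And>y. y \<in> X \<Longrightarrow> dist y a < r \<Longrightarrow> connected_component (X - cball p (inverse (Suc k))) a y"
      using component_near_point[OF X(2) closed_cball] by blast
    show "\<exists>T. openin (top_of_set (X - {p})) T \<and> a \<in> T \<and> (\<forall>x\<in>T. R a x)"
    proof (intro exI conjI ballI)
      show "openin (top_of_set (X - {p})) ((X - {p}) \<inter> ball a r)" by (simp add: openin_open_Int)
      show "a \<in> (X - {p}) \<inter> ball a r" using a r by simp
      fix x assume "x \<in> (X - {p}) \<inter> ball a r"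
      then show "R a x" unfolding R_def using r(2)[of x] by (auto simp: dist_commute)
    qed
  qed
  have "openin (top_of_set X) (W k)" for k
  proof (cases "x0 \<in> X - cball p (inverse (Suc k))")
    case True
    then show ?thesis
      unfolding W_def
      using X(2) openin_Diff_closed[OF closed_cball] locally_connected_open_connected_component by blast
  next
    case False
    then show ?thesis
      unfolding W_def by (metis connected_component_eq_empty openin_empty)
  qed
  then obtain O' where O': "\<And>k. open (O' k)" "\<And>k. W k = X \<inter> O' k"
    unfolding openin_open by metis
  have K: "compact (X - ball p e)"
    using X(1) by (simp add: compact_diff)
  have cover: "X - ball p e \<subseteq> (\<Union>k\<in>UNIV. O' k)"
  proof
    fix y assume y: "y \<in> X - ball p e"
    then have "y \<in> X - {p}" using \<open>e > 0\<close> by auto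
    then obtain k where "y \<in> W k" using Rx0 unfolding R_def W_def by auto
    then show "y \<in> (\<Union>k\<in>UNIV. O' k)" using O' by blast
  qed
  obtain N where N: "finite N" "X - ball p e \<subseteq> (\<Union>k\<in>N. O' k)"
    by (rule compactE_image[OF K _ cover]) (use O'(1) in auto)
  \<comment> \<open>As the \<open>W k\<close> increase, the largest index of the finite subcover
    serves for all far points.\<close>
  obtain m where m: "\<And>k. k \<in> N \<Longrightarrow> k \<le> m"
    using N(1) finite_nat_set_iff_bounded_le by auto
  have W: "y \<in> W m" if y: "y \<in> X - ball p e" for y
  proof -
    from y N(2) obtain k where "k \<in> N" "y \<in> O' k" by blast
    then have "k \<le> m" "y \<in> W k" using m y O'(2) by auto
    then show ?thesis unfolding W_def using mono[of k x0 y m] by simp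
  qed
  show ?thesis
  proof (rule that[of "inverse (Suc m)"])
    show "inverse (real (Suc m)) > 0" by simp
    fix S x y
    assume S: "S \<subseteq> ball p (inverse (Suc m))" and xy: "x \<in> X - ball p e" "y \<in> X - ball p e"
    have "connected_component (X - cball p (inverse (Suc m))) x y"
      using W[OF xy(1)] W[OF xy(2)] unfolding W_def
      by (metis connected_component_sym connected_component_trans mem_Collect_eq)
    then show "connected_component (X - S) x y"
      by (rule connected_component_of_subset) (use S in force)
  qed
qed

text \<open>\<open>g\<close> pulls back a connected set joining \<open>f u\<close> to
  \<open>f v\<close>. The use is contrapositive: the image of a separating set separates the images
  of the points.\<close>

lemma homeomorphism_connected_component:
  assumes h: "homeomorphism X X f g" and "S \<subseteq> X" "u \<in> X" "v \<in> X"
    and c: "connected_component (X - f ` S) (f u) (f v)"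
  shows "connected_component (X - S) u v"
proof -
  obtain T where T: "connected T" "T \<subseteq> X - f ` S" "f u \<in> T" "f v \<in> T"
    using c unfolding connected_component_def by blast
  have "connected (g ` T)"
    using T h by (meson Diff_subset connected_continuous_image continuous_on_subset homeomorphism_def order_trans)
  moreover have "g ` T \<subseteq> X - S"
  proof
    fix z assume "z \<in> g ` T"
    then obtain t where t: "t \<in> T" "z = g t" by blast
    then have "f z = t" "z \<in> X" using h T(2) unfolding homeomorphism_def by blast+
    then show "z \<in> X - S" using T(2) t by blast
  qed
  moreover have "u \<in> g ` T" "v \<in> g ` T"
    using T(3,4) assms(3,4) h unfolding homeomorphism_def by (metis imageI)+
  ultimately show ?thesis
    unfolding connected_component_def by blast
qed

section \<open>Attractors\<close>

definition shrinks :: "(nat \<Rightarrow> 'a \<Rightarrow> 'a) \<Rightarrow> 'a::metric_space set \<Rightarrow> 'a \<Rightarrow> bool" where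
  "shrinks F C p \<longleftrightarrow> (\<forall>e>0. \<forall>\<^sub>F i in sequentially. F i ` C \<subseteq> ball p e)"

text \<open>Convergence dynamics whose domain and range may differ: the repeller \<open>n\<close>
  lies in \<open>A\<close>, the attractor \<open>p\<close> in the eventual image
  \<open>A'\<close>.\<close>

definition source_sink ::
  "(nat \<Rightarrow> 'a \<Rightarrow> 'a) \<Rightarrow> 'a::metric_space set \<Rightarrow> 'a set \<Rightarrow> 'a \<Rightarrow> 'a \<Rightarrow> bool" where
  "source_sink F A A' n p \<longleftrightarrow> n \<in> A \<and> p \<in> A' \<and> (\<forall>\<^sub>F i in sequentially. F i ` A = A') \<and>
     (\<forall>C. compact C \<and> C \<subseteq> A - {n} \<longrightarrow> shrinks F C p)"

text \<open>The two outcomes that nullness leaves along a suitable subsequence: images that contract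
  to a point, or images that stay equal to one set.\<close>

definition attracted :: "(nat \<Rightarrow> 'a \<Rightarrow> 'a) \<Rightarrow> 'a::metric_space set \<Rightarrow> 'a \<Rightarrow> bool" where
  "attracted F A p \<longleftrightarrow> shrinks F A p \<or> (\<exists>A' n. source_sink F A A' n p)"

lemma shrinks_tendsto:
  assumes "shrinks F C p" "x \<in> C"
  shows "(\<lambda>i. F i x) \<longlonglongrightarrow> p"
proof (rule tendstoI)
  fix e :: real assume "e > 0"
  then have "\<forall>\<^sub>F i in sequentially. F i ` C \<subseteq> ball p e" using assms by (simp add: shrinks_def)
  then show "\<forall>\<^sub>F i in sequentially. dist (F i x) p < e"
    by eventually_elim (use assms(2) in \<open>auto simp: dist_commute\<close>)
qed

lemma source_sink_tendsto: "source_sink F A A' n p \<Longrightarrow> x \<in> A \<Longrightarrow> x \<noteq> n \<Longrightarrow> (\<lambda>i. F i x) \<longlonglongrightarrow> p"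
  by (rule shrinks_tendsto[of _ "{x}"]) (auto simp: source_sink_def)

text \<open>A set rather than a point, so that shrinking members, which have no source, can be
  handled together with the others.\<close>

definition sources :: "(nat \<Rightarrow> 'a \<Rightarrow> 'a) \<Rightarrow> 'a::metric_space set \<Rightarrow> 'a \<Rightarrow> 'a set" where
  "sources F A p = {n. \<exists>A'. source_sink F A A' n p}"

lemma attracted_tendsto:
  assumes "attracted F A p" "x \<in> A - sources F A p"
  shows "(\<lambda>i. F i x) \<longlonglongrightarrow> p"
proof (cases "shrinks F A p")
  case True
  then show ?thesis using shrinks_tendsto assms(2) by blast
next
  case False
  then obtain A' n where ss: "source_sink F A A' n p" using assms(1) by (auto simp: attracted_def)
  moreover have "x \<noteq> n" using assms(2) ss by (auto simp: sources_def)
  ultimately show ?thesis using source_sink_tendsto assms(2) by blast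
qed

lemma shrinks_subseq: "shrinks F C p \<Longrightarrow> strict_mono r \<Longrightarrow> shrinks (F \<circ> r) C p"
  unfolding shrinks_def by (auto intro: eventually_subseq)

lemma attracted_subseq:
  assumes "attracted F A p" "strict_mono r"
  shows "attracted (F \<circ> r) A p"
proof -
  have "source_sink (F \<circ> r) A A' n p" if "source_sink F A A' n p" for A' n
  proof -
    have "\<forall>\<^sub>F i in sequentially. (F \<circ> r) i ` A = A'"
      using that eventually_subseq[OF assms(2), of "\<lambda>i. F i ` A = A'"]
      by (simp add: source_sink_def)
    then show ?thesis
      using that shrinks_subseq[OF _ assms(2)] unfolding source_sink_def by blast
  qed
  then show ?thesis
    using assms shrinks_subseq unfolding attracted_def by blast
qed

text \<open>A diagonal subsequence refines each stage only from some index on, so properties of its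
  tails must pass to the whole sequence.\<close>

lemma shrinks_shift: "shrinks (\<lambda>i. F (i + k)) C p \<longleftrightarrow> shrinks F C p"
  unfolding shrinks_def eventually_sequentially_seg[of "\<lambda>i. F i ` C \<subseteq> ball p _" k] ..

lemma attracted_shift: "attracted (\<lambda>i. F (i + k)) A p \<longleftrightarrow> attracted F A p"
  unfolding attracted_def source_sink_def shrinks_shift
    eventually_sequentially_seg[of "\<lambda>i. F i ` A = _" k] ..

section \<open>Families satisfying the crossing condition\<close>

text \<open>No maps appear here, so that a sequence and the sequence of its inverses can later act
  on the same family.\<close>

locale crossing_family =
  fixes X :: "'a::metric_space set" and \<A> :: "'a set set"
  assumes compact_X: "compact X" and locally_connected_X: "locally connected X"
    and no_cut_points_X: "no_cut_points X"
    and closed_mem: "A \<in> \<A> \<Longrightarrow> closed A" and mem_subset: "A \<in> \<A> \<Longrightarrow> A \<subseteq> X"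
    and card_mem: "A \<in> \<A> \<Longrightarrow> infinite A \<or> card A > 2"
    and crossing_single: "A \<in> \<A> \<Longrightarrow> B \<in> \<A> \<Longrightarrow> A \<inter> B = {c} \<Longrightarrow> b \<in> B - {c}
      \<Longrightarrow> crossing_seq_avoiding X \<A> {b, c} A B"
    and crossing_not_single: "A \<in> \<A> \<Longrightarrow> B \<in> \<A> \<Longrightarrow> finite (A \<inter> B) \<Longrightarrow> card (A \<inter> B) \<le> 2
      \<Longrightarrow> card (A \<inter> B) \<noteq> 1 \<Longrightarrow> crossing_seq_avoiding X \<A> (A \<inter> B) A B"

lemma crosses_commute: "crosses X A B \<Longrightarrow> crosses X B A"
  unfolding crosses_def by blast

context crossing_family
begin

lemma mem_obtain_avoiding:
  assumes "A \<in> \<A>"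
  obtains z where "z \<in> A" "z \<noteq> x" "z \<noteq> y"
proof -
  have "\<not> A \<subseteq> {x, y}"
  proof
    assume A: "A \<subseteq> {x, y}"
    then have "card A \<le> card {x, y}" by (intro card_mono) auto
    also have "\<dots> \<le> 2" by (simp add: card_insert_if)
    finally show False using card_mem[OF assms] A finite_subset[OF A] by auto
  qed
  then show ?thesis using that by auto
qed

lemma compact_mem: "A \<in> \<A> \<Longrightarrow> compact A"
  using compact_Int_closed[OF compact_X closed_mem, of A] mem_subset[of A] by (simp add: inf.absorb2)

section \<open>Chains of crossing members that avoid a prescribed set\<close>

definition avoiding :: "'a set \<Rightarrow> 'a set set" where
  "avoiding D = {M \<in> \<A>. D \<inter> M = {}}"

text \<open>A crossing sequence recast as reachability between its first and last inner members
  \<open>M\<close> and \<open>N\<close>, which suits reversal and induction. Only the inner members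
  avoid \<open>D\<close>; \<open>A\<close> and \<open>B\<close> may meet it.\<close>

definition linked :: "'a set \<Rightarrow> 'a set \<Rightarrow> 'a set \<Rightarrow> bool" where
  "linked D A B \<longleftrightarrow> (\<exists>M\<in>avoiding D. \<exists>N\<in>avoiding D. crosses X A M \<and>
     (\<lambda>U V. U \<in> avoiding D \<and> V \<in> avoiding D \<and> crosses X U V)\<^sup>*\<^sup>* M N \<and> crosses X N B)"

lemma linked_if_crossing_seq:
  assumes "crossing_seq_avoiding X \<A> D A B"
  shows "linked D A B"
proof -
  obtain As where "As \<noteq> []" "set As \<subseteq> \<A>" "\<forall>M\<in>set As. D \<inter> M = {}"
    and seq: "\<forall>i<length (A # As @ [B]) - 1. crosses X ((A # As @ [B]) ! i) ((A # As @ [B]) ! Suc i)"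
    using assms unfolding crossing_seq_avoiding_def Let_def by auto
  then have As: "As \<noteq> []" "set As \<subseteq> avoiding D"
    by (auto simp: avoiding_def)
  note L = seq[rule_format]
  \<comment> \<open>In \<open>A # As @ [B]\<close> the entry \<open>As ! j\<close> sits at position
    \<open>Suc j\<close>.\<close>
  have step: "crosses X (As ! j) (As ! Suc j)" if "Suc j < length As" for j
    using L[of "Suc j"] that by (simp add: nth_append)
  have path: "(\<lambda>U V. U \<in> avoiding D \<and> V \<in> avoiding D \<and> crosses X U V)\<^sup>*\<^sup>* (As ! 0) (As ! j)"
    if "j < length As" for j
    using that
  proof (induction j)
    case (Suc j)
    then show ?case
      using step[of j] As(2) by (intro rtranclp.rtrancl_into_rtrancl[OF Suc.IH]) auto
  qed simp
  have "crosses X A (As ! 0)"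
    using L[of 0] As(1) by (simp add: nth_append)
  moreover have "crosses X (As ! (length As - 1)) B"
    using L[of "length As"] As(1) by (simp add: nth_append nth_Cons')
  moreover have "As ! 0 \<in> avoiding D" "As ! (length As - 1) \<in> avoiding D"
    using As by (auto intro!: subsetD[OF As(2)] nth_mem)
  moreover note path[of "length As - 1"]
  ultimately show ?thesis
    unfolding linked_def using As(1) by auto
qed

lemma linked_commute:
  assumes "linked D A B"
  shows "linked D B A"
proof -
  let ?R = "\<lambda>U V. U \<in> avoiding D \<and> V \<in> avoiding D \<and> crosses X U V"
  have "symp ?R" by (auto simp: symp_def crosses_commute)
  then have "symp ?R\<^sup>*\<^sup>*" by (rule symp_rtranclp)
  moreover obtain M N where MN: "M \<in> avoiding D" "N \<in> avoiding D" "crosses X A M" "?R\<^sup>*\<^sup>* M N" "crosses X N B"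
    using assms unfolding linked_def by blast
  ultimately have "?R\<^sup>*\<^sup>* N M" by (meson sympD)
  then show ?thesis
    unfolding linked_def using MN crosses_commute[OF MN(3)] crosses_commute[OF MN(5)] by blast
qed

text \<open>The crossing condition offers an extra avoided point only in the second set; exchanging
  the sets and reversing the chain allows it in either.\<close>

lemma linked_single:
  assumes "A \<in> \<A>" "B \<in> \<A>" "A \<inter> B = {c}" "b \<in> (A \<union> B) - {c}"
  shows "linked {b, c} A B"
proof (cases "b \<in> B")
  case True
  then have "crossing_seq_avoiding X \<A> {b, c} A B"
    using assms by (intro crossing_single) auto
  then show ?thesis by (rule linked_if_crossing_seq)
next
  case False
  then have "crossing_seq_avoiding X \<A> {b, c} B A"
    using assms by (intro crossing_single) auto
  then show ?thesis using linked_if_crossing_seq linked_commute by blast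
qed

end

section \<open>Sequences of homeomorphisms acting on a crossing family\<close>

locale crossing_dynamics = crossing_family +
  fixes F H :: "nat \<Rightarrow> 'a \<Rightarrow> 'a"
  assumes homeo: "homeomorphism X X (F i) (H i)"
    and image_mem: "A \<in> \<A> \<Longrightarrow> F i ` A \<in> \<A>"
    and attracted_ex: "A \<in> \<A> \<Longrightarrow> \<exists>p. attracted F A p"
begin

lemma F_in_X: "x \<in> X \<Longrightarrow> F i x \<in> X"
  using homeo unfolding homeomorphism_def by blast

lemma inj_on_F: "inj_on (F i) X"
  using homeo[of i] by (metis homeomorphism_def inj_on_inverseI)

lemma image_Int_mem: "A \<in> \<A> \<Longrightarrow> B \<in> \<A> \<Longrightarrow> F i ` (A \<inter> B) = F i ` A \<inter> F i ` B"
  by (rule inj_on_image_Int[OF inj_on_F]) (use mem_subset in blast)+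

lemma mem_if_image_mem: "A \<in> \<A> \<Longrightarrow> x \<in> X \<Longrightarrow> F i x \<in> F i ` A \<Longrightarrow> x \<in> A"
  using inj_on_image_mem_iff[OF inj_on_F] mem_subset by blast

lemma source_sink_target_mem:
  assumes "source_sink F A A' n p" "A \<in> \<A>"
  shows "A' \<in> \<A>"
proof -
  have "\<forall>\<^sub>F i in sequentially. F i ` A = A'" using assms by (simp add: source_sink_def)
  then obtain i where "F i ` A = A'" using eventually_happens by force
  then show ?thesis using image_mem assms by blast
qed

lemma attractor_in_X:
  assumes "attracted F A p" "A \<in> \<A>"
  shows "p \<in> X"
proof (cases "shrinks F A p")
  case True
  obtain a where "a \<in> A" using mem_obtain_avoiding[OF assms(2)] by blast
  then have "(\<lambda>i. F i a) \<longlonglongrightarrow> p" "\<forall>i. F i a \<in> X"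
    using True shrinks_tendsto F_in_X mem_subset assms(2) by blast+
  then show ?thesis
    using closed_sequentially[OF compact_imp_closed[OF compact_X], of "\<lambda>i. F i a"] by simp
next
  case False
  then obtain A' n where ss: "source_sink F A A' n p"
    using assms unfolding attracted_def by blast
  then have "p \<in> A'" by (simp add: source_sink_def)
  then show ?thesis using source_sink_target_mem[OF ss assms(2)] mem_subset by blast
qed

text \<open>If \<open>n\<close> were isolated in \<open>A\<close>, then \<open>A - {n}\<close> would
  be compact and shrink to \<open>p\<close>. But \<open>A'\<close> has two points other than
  \<open>p\<close>, and eventually both would have to be the image of \<open>n\<close>.\<close>

lemma source_limit_point:
  assumes ss: "source_sink F A A' n p" and "A \<in> \<A>"
  shows "n islimpt A"
proof (rule ccontr)
  assume "\<not> n islimpt A"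
  then obtain T where T: "open T" "n \<in> T" "\<And>y. y \<in> A \<Longrightarrow> y \<in> T \<Longrightarrow> y = n"
    unfolding islimpt_def by blast
  then have "A - {n} = A - T" by blast
  then have "compact (A - {n})"
    using compact_mem[OF \<open>A \<in> \<A>\<close>] T(1) by (simp add: compact_diff)
  then have sh: "shrinks F (A - {n}) p"
    using ss by (simp add: source_sink_def)
  have A': "A' \<in> \<A>" using source_sink_target_mem assms by blast
  obtain a where a: "a \<in> A'" "a \<noteq> p" using mem_obtain_avoiding[OF A'] by blast
  obtain b where b: "b \<in> A'" "b \<noteq> p" "b \<noteq> a" using mem_obtain_avoiding[OF A'] by blast
  \<comment> \<open>For large \<open>i\<close> the image of \<open>A - {n}\<close> stays closer to
    \<open>p\<close> than \<open>z\<close> is, which leaves \<open>n\<close> as the only preimage of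
    \<open>z\<close>.\<close>
  have ev: "\<forall>\<^sub>F i in sequentially. F i n = z" if z: "z \<in> A'" "z \<noteq> p" for z
  proof -
    have "\<forall>\<^sub>F i in sequentially. F i ` (A - {n}) \<subseteq> ball p (dist p z)"
      using sh z unfolding shrinks_def by simp
    moreover have "\<forall>\<^sub>F i in sequentially. F i ` A = A'"
      using ss by (simp add: source_sink_def)
    ultimately show ?thesis
    proof eventually_elim
      case (elim i)
      then obtain x where x: "x \<in> A" "F i x = z" using z by blast
      have "x = n"
      proof (rule ccontr)
        assume "x \<noteq> n"
        then have "F i x \<in> ball p (dist p z)" using elim(1) x by blast
        then show False using x by simp
      qed
      then show ?case using x by simp
    qed
  qed
  have "\<forall>\<^sub>F i in sequentially. F i n = a \<and> F i n = b"
    using ev[OF a] ev[OF b(1,2)] by (rule eventually_conj)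
  then have "\<exists>i. F i n = a \<and> F i n = b" using eventually_happens by force
  then show False using b(3) by auto
qed

text \<open>As the source of \<open>B\<close> is a limit point of \<open>B\<close>, it can be traded for a nearby point.\<close>

lemma separated_pair:
  assumes "A \<in> \<A>" "B \<in> \<A>" "A \<inter> B = {}" "attracted F B p" and sep: "separates_set X A B"
  obtains u v where "u \<in> B" "v \<in> B" "\<not> connected_component (X - A) u v"
    "(\<lambda>i. F i u) \<longlonglongrightarrow> p" "(\<lambda>i. F i v) \<longlonglongrightarrow> p"
proof -
  obtain x y where xy: "x \<in> B" "y \<in> B" "\<not> connected_component (X - A) x y"
    using sep unfolding separates_set_def separates_def by blast
  show ?thesis
  proof (cases "shrinks F B p")
    case True
    then show ?thesis using that[OF xy] shrinks_tendsto xy by blast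
  next
    case False
    then obtain B' n where ss: "source_sink F B B' n p"
      using assms(4) unfolding attracted_def by blast
    then have n: "n \<in> B" by (simp add: source_sink_def)
    then have nX: "n \<in> X - A" using assms mem_subset by blast
    \<comment> \<open>If the component of \<open>n\<close> contained all of \<open>B\<close>, it
      would join \<open>x\<close> to \<open>y\<close>.\<close>
    obtain u where u: "u \<in> B" "\<not> connected_component (X - A) n u"
      using xy by (meson connected_component_sym connected_component_trans)
    obtain e where e: "e > 0" "\<And>y. y \<in> X \<Longrightarrow> dist y n < e \<Longrightarrow> connected_component (X - A) n y"
      using component_near_point[OF locally_connected_X closed_mem[OF assms(1)] nX] by blast
    obtain v where v: "v \<in> B" "v \<noteq> n" "dist v n < e"
      using source_limit_point[OF ss assms(2)] e(1) unfolding islimpt_approachable by blast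
    then have nv: "connected_component (X - A) n v" using e(2) mem_subset[OF assms(2)] by blast
    have "u \<noteq> n" using u(2) nX by auto
    moreover have "\<not> connected_component (X - A) u v"
      using u(2) nv by (meson connected_component_sym connected_component_trans)
    ultimately show ?thesis
      using that[of u v] u v source_sink_tendsto[OF ss] by blast
  qed
qed

section \<open>Members that cross without meeting\<close>

text \<open>\<open>A\<close> separates two points of \<open>B\<close> that both move to
  \<open>q\<close>. If \<open>p\<close> and \<open>q\<close> differed, the images of
  \<open>A\<close> would be tiny sets near \<open>p\<close> separating points far from
  \<open>p\<close>, which the absence of cut points forbids.\<close>

lemma attractors_eq_if_disjoint_crossing:
  assumes "A \<in> \<A>" "B \<in> \<A>" "A \<inter> B = {}" "shrinks F A p" "attracted F B q"
    and cr: "crosses X A B"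
  shows "p = q"
proof (rule ccontr)
  assume "p \<noteq> q"
  \<comment> \<open>Half the distance keeps every point within \<open>e\<close> of \<open>q\<close>
    outside \<open>ball p e\<close>.\<close>
  define e where "e = dist p q / 2"
  have "e > 0" using \<open>p \<noteq> q\<close> by (simp add: e_def)
  have "separates_set X A B" using cr assms(3) by (simp add: crosses_def)
  then obtain u v where uv: "u \<in> B" "v \<in> B" "\<not> connected_component (X - A) u v"
    "(\<lambda>i. F i u) \<longlonglongrightarrow> q" "(\<lambda>i. F i v) \<longlonglongrightarrow> q"
    using separated_pair assms by metis
  have "p \<in> X" using attractor_in_X assms unfolding attracted_def by blast
  then obtain d where d: "d > 0" "\<And>S x y. S \<subseteq> ball p d \<Longrightarrow> x \<in> X - ball p e
      \<Longrightarrow> y \<in> X - ball p e \<Longrightarrow> connected_component (X - S) x y"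
    using small_set_not_separating[OF compact_X locally_connected_X no_cut_points_X _ \<open>e > 0\<close>] by blast
  have "\<forall>\<^sub>F i in sequentially. F i ` A \<subseteq> ball p d"
    using assms(4) d(1) by (simp add: shrinks_def)
  moreover have "\<forall>\<^sub>F i in sequentially. dist (F i u) q < e" "\<forall>\<^sub>F i in sequentially. dist (F i v) q < e"
    using uv \<open>e > 0\<close> by (auto dest: tendstoD)
  ultimately have "\<forall>\<^sub>F i in sequentially. False"
  proof eventually_elim
    case (elim i)
    have far: "x \<notin> ball p e" if "dist x q < e" for x
      using that dist_triangle[of p q x] by (simp add: e_def dist_commute)
    have "u \<in> X" "v \<in> X" using uv mem_subset assms(2) by blast+
    then have "connected_component (X - F i ` A) (F i u) (F i v)"
      using elim far F_in_X by (intro d(2)) auto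
    then show False
      using homeomorphism_connected_component[OF homeo mem_subset[OF assms(1)] \<open>u \<in> X\<close> \<open>v \<in> X\<close>] uv(3)
      by blast
  qed
  then show False by simp
qed

text \<open>The eventual images \<open>A'\<close> and \<open>B'\<close> are disjoint, so
  \<open>q\<close> lies off the closed set \<open>A'\<close>. Two points of \<open>B\<close>
  separated by \<open>A\<close> would both move to \<open>q\<close> and end in one component of
  \<open>X - A'\<close>.\<close>

lemma source_sink_not_disjoint_crossing:
  assumes "A \<in> \<A>" "B \<in> \<A>" "A \<inter> B = {}" "source_sink F A A' m p" "source_sink F B B' n q"
  shows "\<not> crosses X A B"
proof
  assume "crosses X A B"
  then have "separates_set X A B" using assms(3) by (simp add: crosses_def)
  moreover have "attracted F B q" using assms by (auto simp: attracted_def)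
  ultimately obtain u v where uv: "u \<in> B" "v \<in> B" "\<not> connected_component (X - A) u v"
    "(\<lambda>i. F i u) \<longlonglongrightarrow> q" "(\<lambda>i. F i v) \<longlonglongrightarrow> q"
    using separated_pair assms by metis
  have ev: "\<forall>\<^sub>F i in sequentially. F i ` A = A'" "\<forall>\<^sub>F i in sequentially. F i ` B = B'"
    using assms by (simp_all add: source_sink_def)
  have "\<forall>\<^sub>F i in sequentially. A' \<inter> B' = {}"
    using ev by eventually_elim (use image_Int_mem[OF assms(1,2)] assms(3) in force)
  then have "A' \<inter> B' = {}" by simp
  moreover have "q \<in> B'" using assms by (simp add: source_sink_def)
  moreover have A': "A' \<in> \<A>" "B' \<in> \<A>" using assms source_sink_target_mem by blast+
  ultimately have "q \<in> X - A'" using mem_subset by blast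
  then obtain e where e: "e > 0" "\<And>y. y \<in> X \<Longrightarrow> dist y q < e \<Longrightarrow> connected_component (X - A') q y"
    using component_near_point[OF locally_connected_X closed_mem[OF A'(1)]] by blast
  have "\<forall>\<^sub>F i in sequentially. dist (F i u) q < e" "\<forall>\<^sub>F i in sequentially. dist (F i v) q < e"
    using uv e(1) by (auto dest: tendstoD)
  then have "\<forall>\<^sub>F i in sequentially. False"
    using ev(1)
  proof eventually_elim
    case (elim i)
    have "u \<in> X" "v \<in> X" using uv mem_subset assms(2) by blast+
    then have "connected_component (X - A') q (F i u)" "connected_component (X - A') q (F i v)"
      using elim F_in_X e(2) by blast+
    then have "connected_component (X - F i ` A) (F i u) (F i v)"
      using elim(3) by (metis connected_component_sym connected_component_trans)
    then show False
      using homeomorphism_connected_component[OF homeo mem_subset[OF assms(1)] \<open>u \<in> X\<close> \<open>v \<in> X\<close>] uv(3)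
      by blast
  qed
  then show False by simp
qed

lemma limit_in_target:
  assumes "source_sink F A A' n p" "A \<in> \<A>" "x \<in> A" "(\<lambda>i. F i x) \<longlonglongrightarrow> q"
  shows "q \<in> A'"
proof -
  have "\<forall>\<^sub>F i in sequentially. F i ` A = A'" using assms by (simp add: source_sink_def)
  then have "\<forall>\<^sub>F i in sequentially. F i x \<in> A'"
    by eventually_elim (use assms(3) in blast)
  then show ?thesis
    by (rule Lim_in_closed_set[OF closed_mem[OF source_sink_target_mem[OF assms(1,2)]] _ sequentially_bot assms(4)])
qed

section \<open>Propagation of attractors along chains\<close>

text \<open>One step along a chain. A common point lies off \<open>D\<close>, hence is no source of
  \<open>U\<close> and moves to \<open>q\<close>; without a common point the results on disjoint
  crossings apply. Either way an eventually constant image of \<open>V\<close> would contain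
  \<open>q\<close>.\<close>

lemma shrinks_if_crossing:
  assumes U: "U \<in> \<A>" "attracted F U q" "sources F U q \<subseteq> D"
    and V: "V \<in> avoiding D" "\<forall>V' n p. source_sink F V V' n p \<longrightarrow> q \<notin> V'"
    and cr: "crosses X U V"
  shows "shrinks F V q"
proof -
  have VA: "V \<in> \<A>" "D \<inter> V = {}" using V(1) by (auto simp: avoiding_def)
  obtain p where p: "attracted F V p" using attracted_ex VA by blast
  show ?thesis
  proof (cases "U \<inter> V = {}")
    case True
    show ?thesis
    proof (cases "shrinks F V p")
      case True
      then show ?thesis
        using attractors_eq_if_disjoint_crossing[OF VA(1) U(1) _ True U(2)] \<open>U \<inter> V = {}\<close> crosses_commute[OF cr]
        by (metis inf_commute)
    next
      case False
      then obtain V' n where ss: "source_sink F V V' n p" using p by (auto simp: attracted_def)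
      then have "shrinks F U q"
        using source_sink_not_disjoint_crossing[OF U(1) VA(1) True] cr U(2) unfolding attracted_def by blast
      then have "q = p"
        using attractors_eq_if_disjoint_crossing[OF U(1) VA(1) True _ p cr] by blast
      then show ?thesis using V(2) ss by (auto simp: source_sink_def)
    qed
  next
    case False
    then obtain y where y: "y \<in> U" "y \<in> V" by blast
    then have lim: "(\<lambda>i. F i y) \<longlonglongrightarrow> q"
      by (intro attracted_tendsto[OF U(2)]) (use U(3) VA(2) in blast)
    have "\<not> source_sink F V V' n p" for V' n
      using limit_in_target[OF _ VA(1) y(2) lim] V(2) by blast
    then have "shrinks F V p" using p by (simp add: attracted_def)
    then have "q = p" using LIMSEQ_unique[OF lim] shrinks_tendsto y(2) by metis
    then show ?thesis using \<open>shrinks F V p\<close> by simp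
  qed
qed

text \<open>As long as no target contains \<open>q\<close>, shrinking to \<open>q\<close> passes
  along the chain to its last member, whose crossing with \<open>B\<close> forces
  \<open>q = p\<close>. Distinct attractors thus produce an obstructing member that avoids
  \<open>D\<close>.\<close>

lemma linked_sink:
  assumes A: "A \<in> \<A>" "attracted F A q" "sources F A q \<subseteq> D"
    and B: "B \<in> \<A>" "attracted F B p" "sources F B p \<subseteq> D"
    and "q \<noteq> p" "linked D A B"
  shows "\<exists>M\<in>avoiding D. \<exists>M' n r. source_sink F M M' n r \<and> q \<in> M'"
proof (rule ccontr)
  assume contr: "\<not> ?thesis"
  have no: "\<forall>M' n r. source_sink F M M' n r \<longrightarrow> q \<notin> M'" if "M \<in> avoiding D" for M
    using that contr by blast
  have ss_q: "q \<in> M'" if "source_sink F M M' n q" for M M' n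
    using that by (simp add: source_sink_def)
  obtain M N where MN: "M \<in> avoiding D" "N \<in> avoiding D" "crosses X A M"
    "(\<lambda>U V. U \<in> avoiding D \<and> V \<in> avoiding D \<and> crosses X U V)\<^sup>*\<^sup>* M N" "crosses X N B"
    using assms(8) unfolding linked_def by blast
  have "shrinks F M q" by (rule shrinks_if_crossing[OF A MN(1) no[OF MN(1)] MN(3)])
  with MN(4) have sN: "shrinks F N q"
  proof (induction rule: rtranclp_induct)
    case (step U V)
    then have UV: "U \<in> avoiding D" "V \<in> avoiding D" "crosses X U V" "shrinks F U q" by auto
    show ?case
    proof (rule shrinks_if_crossing[OF _ _ _ UV(2) no[OF UV(2)] UV(3)])
      show "U \<in> \<A>" using UV(1) by (simp add: avoiding_def)
      show "attracted F U q" using UV(4) by (simp add: attracted_def)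
      \<comment> \<open>A source of \<open>U\<close> for the attractor \<open>q\<close> would come
        with a target containing \<open>q\<close>.\<close>
      show "sources F U q \<subseteq> D"
        using no[OF UV(1)] ss_q by (auto simp: sources_def)
    qed
  qed
  have N: "N \<in> \<A>" "D \<inter> N = {}" using MN(2) by (auto simp: avoiding_def)
  show False
  proof (cases "N \<inter> B = {}")
    case True
    then show ?thesis
      using attractors_eq_if_disjoint_crossing[OF N(1) B(1) True sN B(2) MN(5)] \<open>q \<noteq> p\<close> by blast
  next
    case False
    then obtain y where y: "y \<in> N" "y \<in> B" by blast
    then have "(\<lambda>i. F i y) \<longlonglongrightarrow> p" by (intro attracted_tendsto[OF B(2)]) (use B(3) N in blast)
    then show ?thesis using LIMSEQ_unique shrinks_tendsto[OF sN y(1)] \<open>q \<noteq> p\<close> by blast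
  qed
qed

section \<open>Intersections of targets and uniqueness of sources\<close>

text \<open>\<open>M \<inter> B\<close> is compact and misses the source \<open>c\<close>, so its
  images shrink to \<open>p\<close>; eventually these images are the fixed set
  \<open>M' \<inter> B'\<close>.\<close>

lemma target_Int_subset:
  assumes "source_sink F B B' c p" "B \<in> \<A>" "source_sink F M M' m r" "M \<in> \<A>" "c \<notin> M"
  shows "M' \<inter> B' \<subseteq> {p}"
proof
  fix z assume z: "z \<in> M' \<inter> B'"
  have "compact (M \<inter> B)" using compact_Int compact_mem assms by blast
  moreover have "M \<inter> B \<subseteq> B - {c}" using assms by blast
  ultimately have sh: "shrinks F (M \<inter> B) p" using assms(1) by (simp add: source_sink_def)
  show "z \<in> {p}"
  proof (rule ccontr)
    assume "z \<notin> {p}"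
    then have "\<forall>\<^sub>F i in sequentially. F i ` (M \<inter> B) \<subseteq> ball p (dist p z)"
      using sh by (simp add: shrinks_def)
    moreover have "\<forall>\<^sub>F i in sequentially. F i ` M = M'" "\<forall>\<^sub>F i in sequentially. F i ` B = B'"
      using assms by (simp_all add: source_sink_def)
    ultimately have "\<forall>\<^sub>F i in sequentially. False"
    proof eventually_elim
      case (elim i)
      then have "z \<in> F i ` (M \<inter> B)" using z image_Int_mem[OF assms(4,2)] by simp
      then have "z \<in> ball p (dist p z)" using elim(1) by blast
      then show False by simp
    qed
    then show False by simp
  qed
qed

lemma not_shrinks_if_source_sink:
  assumes "source_sink F A A' n p" "A \<in> \<A>"
  shows "\<not> shrinks F A q"
proof
  assume sh: "shrinks F A q"
  obtain z where z: "z \<in> A'" "z \<noteq> q"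
    using mem_obtain_avoiding[OF source_sink_target_mem[OF assms]] by blast
  have "\<forall>\<^sub>F i in sequentially. F i ` A \<subseteq> ball q (dist q z)"
    using sh z by (simp add: shrinks_def)
  moreover have "\<forall>\<^sub>F i in sequentially. F i ` A = A'"
    using assms by (simp add: source_sink_def)
  ultimately have "\<forall>\<^sub>F i in sequentially. False"
  proof eventually_elim
    case (elim i)
    then have "z \<in> ball q (dist q z)" using z by blast
    then show False by simp
  qed
  then show False by simp
qed

text \<open>The complements of disjoint balls about two sources cover \<open>A\<close>, and each
  part shrinks to \<open>p\<close>; then all of \<open>A\<close> would shrink.\<close>

lemma source_unique:
  assumes "source_sink F A A' n p" "source_sink F A A'' m p" "A \<in> \<A>"
  shows "m = n"
proof (rule ccontr)
  assume "m \<noteq> n"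
  define e where "e = dist m n / 2"
  have e: "e > 0" using \<open>m \<noteq> n\<close> by (simp add: e_def)
  have cover: "A = (A - ball n e) \<union> (A - ball m e)"
  proof -
    have "ball n e \<inter> ball m e = {}"
      by (rule disjoint_ballI) (simp add: e_def dist_commute)
    then show ?thesis by blast
  qed
  have cpt: "compact (A - ball x e)" for x
    using compact_mem[OF assms(3)] by (simp add: compact_diff)
  have "shrinks F (A - ball n e) p" "shrinks F (A - ball m e) p"
    using assms cpt e unfolding source_sink_def by (metis Diff_mono centre_in_ball empty_subsetI insert_subset order_refl)+
  then have "shrinks F ((A - ball n e) \<union> (A - ball m e)) p"
    unfolding shrinks_def by (simp add: image_Un eventually_conj_iff)
  then show False
    using not_shrinks_if_source_sink[OF assms(1,3)] cover by simp
qed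

lemma sources_source_sink:
  assumes "source_sink F A A' n p" "A \<in> \<A>"
  shows "sources F A p = {n}"
  using source_unique[OF assms(1) _ assms(2)] assms(1) unfolding sources_def by blast

lemma sources_shrinks: "shrinks F A q \<Longrightarrow> A \<in> \<A> \<Longrightarrow> sources F A p = {}"
  using not_shrinks_if_source_sink unfolding sources_def by blast

section \<open>Members that meet in a source\<close>

text \<open>If \<open>p\<close> and \<open>q\<close> differ, the sets meet only in the source
  \<open>c\<close>, whose images tend to \<open>p\<close>; so \<open>p\<close> lies in
  \<open>B'\<close>. A chain avoiding \<open>c\<close> yields a target \<open>M'\<close> containing
  \<open>p\<close>, while \<open>M'\<close> and \<open>B'\<close> can meet only in
  \<open>q\<close>.\<close>

lemma attractors_eq_if_shrinks_intersecting:
  assumes AB: "A \<in> \<A>" "B \<in> \<A>" "A \<inter> B \<noteq> {}"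
    and sh: "shrinks F A p" and ss: "source_sink F B B' c q"
  shows "p = q"
proof (rule ccontr)
  assume "p \<noteq> q"
  have "y = c" if "y \<in> A \<inter> B" for y
  proof (rule ccontr)
    assume "y \<noteq> c"
    then have "(\<lambda>i. F i y) \<longlonglongrightarrow> q" using source_sink_tendsto[OF ss] that by blast
    moreover have "(\<lambda>i. F i y) \<longlonglongrightarrow> p" using shrinks_tendsto[OF sh] that by blast
    ultimately show False using LIMSEQ_unique \<open>p \<noteq> q\<close> by blast
  qed
  then have c: "A \<inter> B = {c}" using AB(3) by blast
  obtain b where "b \<in> B" "b \<noteq> c" using mem_obtain_avoiding[OF AB(2)] by metis
  then have lk: "linked {b, c} A B" using linked_single[OF AB(1,2) c] by blast
  have at: "attracted F A p" "attracted F B q" using sh ss by (auto simp: attracted_def)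
  have "sources F A p \<subseteq> {b, c}" "sources F B q \<subseteq> {b, c}"
    using sources_shrinks[OF sh AB(1)] sources_source_sink[OF ss AB(2)] by auto
  then obtain M M' n r where M: "M \<in> avoiding {b, c}" "source_sink F M M' n r" "p \<in> M'"
    using linked_sink[OF AB(1) at(1) _ AB(2) at(2) _ \<open>p \<noteq> q\<close> lk] by blast
  have "p \<in> B'"
    using limit_in_target[OF ss AB(2)] shrinks_tendsto[OF sh] c by blast
  moreover have "M \<in> \<A>" "c \<notin> M" using M(1) by (auto simp: avoiding_def)
  then have "M' \<inter> B' \<subseteq> {q}" using target_Int_subset[OF ss AB(2) M(2)] by blast
  ultimately show False using M(3) \<open>p \<noteq> q\<close> by blast
qed

text \<open>The obstructing member \<open>M\<close> would have the eventual image \<open>p\<close>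
  of \<open>y\<close> in its target. Injectivity then puts \<open>y\<close> into \<open>M\<close>,
  although \<open>M\<close> avoids \<open>D\<close>.\<close>

lemma linked_sink_not_hit:
  assumes AB: "A \<in> \<A>" "B \<in> \<A>" "source_sink F A A' m p" "source_sink F B B' n q" "p \<noteq> q"
    and D: "m \<in> D" "n \<in> D" "y \<in> D" "y \<in> X" "linked D A B"
  shows "\<not> (\<forall>\<^sub>F i in sequentially. F i y = p)"
proof
  assume ev: "\<forall>\<^sub>F i in sequentially. F i y = p"
  have at: "attracted F A p" "attracted F B q" using AB by (auto simp: attracted_def)
  have "sources F A p \<subseteq> D" "sources F B q \<subseteq> D"
    using sources_source_sink[OF AB(3,1)] sources_source_sink[OF AB(4,2)] D(1,2) by auto
  then obtain M M' l r where M: "M \<in> avoiding D" "source_sink F M M' l r" "p \<in> M'"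
    using linked_sink[OF AB(1) at(1) _ AB(2) at(2) _ AB(5) D(5)] by blast
  have MA: "M \<in> \<A>" "D \<inter> M = {}" using M(1) by (auto simp: avoiding_def)
  have "\<forall>\<^sub>F i in sequentially. F i ` M = M'" using M(2) by (simp add: source_sink_def)
  with ev have "\<forall>\<^sub>F i in sequentially. False"
  proof eventually_elim
    case (elim i)
    then have "y \<in> M" using mem_if_image_mem[OF MA(1) D(4)] M(3) by blast
    then show False using MA(2) D(3) by blast
  qed
  then show False by simp
qed

text \<open>The source \<open>n\<close> of \<open>B\<close> lies in \<open>A\<close> without being
  its source, so it moves to \<open>p\<close> inside the finite set \<open>A' \<inter> B'\<close>
  and must eventually land on \<open>p\<close>. A chain avoiding both sources rules this out if
  \<open>p\<close> and \<open>q\<close> differ.\<close>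

lemma attractors_eq_if_saddle:
  assumes AB: "A \<in> \<A>" "B \<in> \<A>" "source_sink F A A' m p" "source_sink F B B' n q"
    and mn: "m \<noteq> n" "n \<in> A" "A \<inter> B \<subseteq> {m, n}"
  shows "p = q"
proof (rule ccontr)
  assume "p \<noteq> q"
  have mem: "m \<in> A" "n \<in> B" using AB by (auto simp: source_sink_def)
  \<comment> \<open>With \<open>m\<close> in \<open>B\<close> the intersection is the pair of
    sources; otherwise it is \<open>{n}\<close>, and \<open>m\<close> serves as the extra point to
    avoid.\<close>
  have "linked {m, n} A B"
  proof (cases "m \<in> B")
    case True
    then have eq: "A \<inter> B = {m, n}" using mem mn by blast
    then have "crossing_seq_avoiding X \<A> (A \<inter> B) A B"
      using mn(1) by (intro crossing_not_single[OF AB(1,2)]) auto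
    then show ?thesis using linked_if_crossing_seq eq by simp
  next
    case False
    then have "A \<inter> B = {n}" using mem mn by blast
    then show ?thesis using linked_single[OF AB(1,2)] mem mn(1) by blast
  qed
  moreover have "\<forall>\<^sub>F i in sequentially. F i n = p"
  proof -
    have ev: "\<forall>\<^sub>F i in sequentially. F i ` A = A'" "\<forall>\<^sub>F i in sequentially. F i ` B = B'"
      using AB by (simp_all add: source_sink_def)
    then have ev2: "\<forall>\<^sub>F i in sequentially. F i ` (A \<inter> B) = A' \<inter> B'"
      by eventually_elim (simp add: image_Int_mem[OF AB(1,2)])
    then have "\<exists>i. F i ` (A \<inter> B) = A' \<inter> B'" using eventually_happens by force
    moreover have "finite (A \<inter> B)" using mn(3) by (rule finite_subset) simp
    ultimately have "finite (A' \<inter> B')" by (metis finite_imageI)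
    \<comment> \<open>Deleting \<open>p\<close> from a finite set leaves a closed set, so
      convergence to \<open>p\<close> eventually excludes its other points.\<close>
    then have op: "open (- (A' \<inter> B' - {p}))" by (intro open_Compl finite_imp_closed) simp
    have "(\<lambda>i. F i n) \<longlonglongrightarrow> p" using source_sink_tendsto[OF AB(3)] mn by blast
    then have "\<forall>\<^sub>F i in sequentially. F i n \<in> - (A' \<inter> B' - {p})"
      by (rule topological_tendstoD[OF _ op]) simp
    with ev2 show ?thesis
      by eventually_elim (use mem mn(2) in blast)
  qed
  moreover have "n \<in> X" using mem mem_subset AB(2) by blast
  ultimately show False
    using linked_sink_not_hit[OF AB \<open>p \<noteq> q\<close>, of "{m, n}" n] by blast
qed

text \<open>The common source need not land on \<open>p\<close>, so two chains are used: the first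
  yields a point of \<open>A\<close> that eventually does, the second avoids that point.\<close>

lemma attractors_eq_if_common_source:
  assumes AB: "A \<in> \<A>" "B \<in> \<A>" "source_sink F A A' c p" "source_sink F B B' c q"
    and c: "A \<inter> B = {c}"
  shows "p = q"
proof (rule ccontr)
  assume "p \<noteq> q"
  obtain b where b: "b \<in> B" "b \<noteq> c" using mem_obtain_avoiding[OF AB(2)] by metis
  then have lk: "linked {b, c} A B" using linked_single[OF AB(1,2) c] by blast
  have at: "attracted F A p" "attracted F B q" using AB by (auto simp: attracted_def)
  have "sources F A p \<subseteq> {b, c}" "sources F B q \<subseteq> {b, c}"
    using sources_source_sink[OF AB(3,1)] sources_source_sink[OF AB(4,2)] by auto
  then obtain M M' n r where M: "M \<in> avoiding {b, c}" "source_sink F M M' n r" "p \<in> M'"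
    using linked_sink[OF AB(1) at(1) _ AB(2) at(2) _ \<open>p \<noteq> q\<close> lk] by blast
  have MA: "M \<in> \<A>" "c \<notin> M" using M(1) by (auto simp: avoiding_def)
  then have "M' \<inter> A' \<subseteq> {p}" using target_Int_subset[OF AB(3,1) M(2)] by blast
  moreover have "p \<in> A'" using AB(3) by (simp add: source_sink_def)
  ultimately have eq: "M' \<inter> A' = {p}" using M(3) by blast
  have ev: "\<forall>\<^sub>F i in sequentially. F i ` A = A'" "\<forall>\<^sub>F i in sequentially. F i ` M = M'"
    using AB M by (simp_all add: source_sink_def)
  then have ev2: "\<forall>\<^sub>F i in sequentially. F i ` (M \<inter> A) = {p}"
    by eventually_elim (simp add: image_Int_mem[OF MA(1) AB(1)] eq)
  then have "\<exists>i. F i ` (M \<inter> A) = {p}" using eventually_happens by force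
  then obtain y where y: "y \<in> M \<inter> A" by blast
  \<comment> \<open>The intersection with \<open>M\<close> pins the attractor down to a single preimage, which the second chain can avoid.\<close>
  have "\<forall>\<^sub>F i in sequentially. F i y = p"
    using ev2 by eventually_elim (use y in blast)
  moreover have "y \<in> (A \<union> B) - {c}" "y \<in> X" using y MA mem_subset[OF AB(1)] by auto
  moreover from this(1) have "linked {y, c} A B" by (rule linked_single[OF AB(1,2) c])
  ultimately show False
    using linked_sink_not_hit[OF AB \<open>p \<noteq> q\<close>, of "{y, c}" y] by blast
qed

text \<open>A common point off the sources would move to both attractors. What remains is a meeting
  in sources: of a shrinking member with another, in a common source, or in a source of one member
  that is not the source of the other.\<close>

lemma attractors_eq_if_intersecting:
  assumes AB: "A \<in> \<A>" "B \<in> \<A>" "A \<inter> B \<noteq> {}" and p: "attracted F A p" and q: "attracted F B q"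
  shows "p = q"
proof (rule ccontr)
  assume "p \<noteq> q"
  have BA: "B \<inter> A \<noteq> {}" using AB(3) by blast
  show False
  proof (cases "shrinks F A p")
    case shA: True
    then have "\<not> source_sink F B B' c q" for B' c
      using attractors_eq_if_shrinks_intersecting[OF AB shA] \<open>p \<noteq> q\<close> by blast
    then have shB: "shrinks F B q" using q by (simp add: attracted_def)
    obtain y where "y \<in> A" "y \<in> B" using AB(3) by blast
    then show False
      using shrinks_tendsto[OF shA, of y] shrinks_tendsto[OF shB, of y] LIMSEQ_unique \<open>p \<noteq> q\<close> by blast
  next
    case False
    then obtain A' m where A': "source_sink F A A' m p" using p by (auto simp: attracted_def)
    then have "\<not> shrinks F B q"
      using attractors_eq_if_shrinks_intersecting[OF AB(2,1) BA _ A'] \<open>p \<noteq> q\<close> by blast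
    then obtain B' n where B': "source_sink F B B' n q" using q by (auto simp: attracted_def)
    have sub: "A \<inter> B \<subseteq> {m, n}"
    proof
      fix y assume y: "y \<in> A \<inter> B"
      show "y \<in> {m, n}"
      proof (rule ccontr)
        assume "y \<notin> {m, n}"
        then have "(\<lambda>i. F i y) \<longlonglongrightarrow> p" "(\<lambda>i. F i y) \<longlonglongrightarrow> q"
          using source_sink_tendsto[OF A'] source_sink_tendsto[OF B'] y by blast+
        then show False using LIMSEQ_unique \<open>p \<noteq> q\<close> by blast
      qed
    qed
    show False
    proof (cases "m = n")
      case True
      then have "A \<inter> B = {n}" using sub AB(3) by blast
      then show False
        using attractors_eq_if_common_source[OF AB(1,2) A'[unfolded True] B'] \<open>p \<noteq> q\<close> by blast
    next
      case False
      \<comment> \<open>The saddle case excludes \<open>n\<close> from \<open>A\<close> and, with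
        roles exchanged, \<open>m\<close> from \<open>B\<close>, which empties the
        intersection.\<close>
      have "n \<notin> A"
        using attractors_eq_if_saddle[OF AB(1,2) A' B' False _ sub] \<open>p \<noteq> q\<close> by blast
      moreover have "B \<inter> A \<subseteq> {n, m}" using sub by blast
      then have "m \<notin> B"
        using attractors_eq_if_saddle[OF AB(2,1) B' A'] False \<open>p \<noteq> q\<close> by blast
      ultimately show False using sub AB(3) by blast
    qed
  qed
qed

section \<open>One attractor for the whole family\<close>

lemma attractors_eq_if_crossing:
  assumes AB: "A \<in> \<A>" "B \<in> \<A>" "crosses X A B" and p: "attracted F A p" and q: "attracted F B q"
  shows "p = q"
proof (cases "A \<inter> B = {}")
  case True
  then have BA: "B \<inter> A = {}" by blast
  have "shrinks F A p \<or> shrinks F B q"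
    using source_sink_not_disjoint_crossing[OF AB(1,2) True] AB(3) p q unfolding attracted_def by blast
  then show ?thesis
    using attractors_eq_if_disjoint_crossing[OF AB(1,2) True _ q AB(3)]
      attractors_eq_if_disjoint_crossing[OF AB(2,1) BA _ p crosses_commute[OF AB(3)]] by metis
next
  case False
  then show ?thesis using attractors_eq_if_intersecting assms by blast
qed

lemma attractors_eq:
  assumes AB: "A \<in> \<A>" "B \<in> \<A>" and p: "attracted F A p" and q: "attracted F B q"
  shows "p = q"
proof (cases "A \<inter> B = {}")
  case True
  \<comment> \<open>An empty intersection has cardinality 0, so the clause for intersections other
    than singletons applies, with nothing to avoid.\<close>
  then have "crossing_seq_avoiding X \<A> (A \<inter> B) A B"
    by (intro crossing_not_single[OF AB]) auto
  then obtain M N where MN: "M \<in> \<A>" "N \<in> \<A>" "crosses X A M"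
    "(\<lambda>U V. U \<in> avoiding {} \<and> V \<in> avoiding {} \<and> crosses X U V)\<^sup>*\<^sup>* M N" "crosses X N B"
    using linked_if_crossing_seq[of "A \<inter> B" A B] True unfolding linked_def avoiding_def by auto
  have "attracted F M p"
    using attracted_ex[OF MN(1)] attractors_eq_if_crossing[OF AB(1) MN(1,3) p] by blast
  with MN(4) have "attracted F N p"
  proof (induction rule: rtranclp_induct)
    case (step U V)
    then have UV: "U \<in> \<A>" "V \<in> \<A>" "crosses X U V" "attracted F U p" by (auto simp: avoiding_def)
    then show ?case
      using attracted_ex[OF UV(2)] attractors_eq_if_crossing[OF UV] by blast
  qed
  then show ?thesis using attractors_eq_if_crossing[OF MN(2) AB(2) MN(5) _ q] by blast
next
  case False
  then show ?thesis using attractors_eq_if_intersecting assms by blast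
qed

end

section \<open>Two-sided dynamics\<close>

text \<open>\<open>H\<close> inverts \<open>F\<close>, so every one-sided result also holds with the
  two exchanged; the attractor of \<open>H\<close> will turn out to be the repeller of
  \<open>F\<close>.\<close>

locale two_sided_dynamics =
  crossing_dynamics X \<A> F H + bwd: crossing_dynamics X \<A> H F
  for X :: "'a::metric_space set" and \<A> F H +
  assumes fine: "x \<in> X \<Longrightarrow> y \<in> X \<Longrightarrow> x \<noteq> y
    \<Longrightarrow> \<exists>\<B>. \<B> \<subseteq> \<A> \<and> finite \<B> \<and> separates X (\<Union>\<B>) {x} {y}"
begin

lemma H_F: "x \<in> X \<Longrightarrow> H i (F i x) = x" and F_H: "x \<in> X \<Longrightarrow> F i (H i x) = x"
  using homeo[of i] by (auto simp: homeomorphism_def)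

text \<open>Two points must be avoided, \<open>p\<close> and a possible source under
  \<open>H\<close>; members have at least three.\<close>

lemma back_tendsto_obtain:
  assumes "A \<in> \<A>" "attracted H A q"
  obtains a where "a \<in> A" "a \<noteq> p" "(\<lambda>i. H i a) \<longlonglongrightarrow> q"
proof (cases "shrinks H A q")
  case True
  obtain a where "a \<in> A" "a \<noteq> p" using mem_obtain_avoiding[OF assms(1)] by blast
  then show ?thesis using that shrinks_tendsto[OF True] by blast
next
  case False
  then obtain A' m where ss: "source_sink H A A' m q" using assms(2) by (auto simp: attracted_def)
  obtain a where "a \<in> A" "a \<noteq> p" "a \<noteq> m" using mem_obtain_avoiding[OF assms(1)] by blast
  then show ?thesis using that source_sink_tendsto[OF ss] by blast
qed

text \<open>A point \<open>a\<close> of \<open>A'\<close> other than \<open>p\<close> eventually has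
  its preimage \<open>H i a\<close> in \<open>A\<close>. Points of \<open>A\<close> away from
  \<open>n\<close> move close to \<open>p\<close>, so these preimages must approach
  \<open>n\<close>, while their limit is \<open>q\<close>.\<close>

lemma source_eq_back_attractor:
  assumes ss: "source_sink F A A' n p" and "A \<in> \<A>" and q: "attracted H A' q"
  shows "n = q"
proof (rule ccontr)
  assume "n \<noteq> q"
  define e where "e = dist n q / 2"
  have e: "e > 0" using \<open>n \<noteq> q\<close> by (simp add: e_def)
  have A': "A' \<in> \<A>" using source_sink_target_mem[OF ss \<open>A \<in> \<A>\<close>] .
  obtain a where a: "a \<in> A'" "a \<noteq> p" "(\<lambda>i. H i a) \<longlonglongrightarrow> q"
    using back_tendsto_obtain[OF A' q] by blast
  have "compact (A - ball n e)"
    using compact_mem[OF \<open>A \<in> \<A>\<close>] by (simp add: compact_diff)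
  moreover have "A - ball n e \<subseteq> A - {n}" using e by auto
  ultimately have "shrinks F (A - ball n e) p" using ss by (simp add: source_sink_def)
  then have "\<forall>\<^sub>F i in sequentially. F i ` (A - ball n e) \<subseteq> ball p (dist p a)"
    using a(2) by (simp add: shrinks_def)
  moreover have "\<forall>\<^sub>F i in sequentially. F i ` A = A'"
    using ss by (simp add: source_sink_def)
  moreover have "\<forall>\<^sub>F i in sequentially. dist (H i a) q < e"
    using a(3) e by (rule tendstoD)
  ultimately have "\<forall>\<^sub>F i in sequentially. False"
  proof eventually_elim
    case (elim i)
    obtain x where x: "x \<in> A" "F i x = a" using elim(2) a(1) by blast
    then have Hx: "H i a = x" using H_F mem_subset[OF \<open>A \<in> \<A>\<close>] by blast
    have "x \<notin> ball n e"
      using elim(3) Hx dist_triangle[of n q x] by (simp add: e_def dist_commute)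
    then have "F i x \<in> ball p (dist p a)" using elim(1) x(1) by blast
    then show False using x(2) by simp
  qed
  then show False by simp
qed

text \<open>If a point near \<open>x\<close> had its image away from \<open>p\<close>, it could be
  joined, off the small image of \<open>\<Union>\<B>\<close>, to a fixed point \<open>a\<close> that
  comes from near \<open>n\<close>; pulling back would join \<open>x\<close> to \<open>n\<close> off
  \<open>\<Union>\<B>\<close>.\<close>

lemma local_collapse:
  assumes A: "A \<in> \<A>" "attracted F A p" "attracted H A n" and x: "x \<in> X" "x \<noteq> n" and "e > 0"
  shows "\<exists>r>0. \<forall>\<^sub>F i in sequentially. F i ` (X \<inter> ball x r) \<subseteq> ball p e"
proof -
  have pX: "p \<in> X" and nX: "n \<in> X"
    using attractor_in_X bwd.attractor_in_X A by blast+
  obtain \<B> where \<B>: "\<B> \<subseteq> \<A>" "finite \<B>" and sep: "separates X (\<Union>\<B>) {x} {n}"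
    using fine[OF x(1) nX x(2)] by blast
  have cl: "closed (\<Union>\<B>)" and xS: "x \<in> X - \<Union>\<B>" and nS: "n \<in> X - \<Union>\<B>"
    and xn: "\<not> connected_component (X - \<Union>\<B>) x n"
    using sep unfolding separates_def by auto
  have sh: "shrinks F B p" if B: "B \<in> \<B>" for B
  proof -
    have BA: "B \<in> \<A>" using B \<B> by blast
    obtain p' where "attracted F B p'" using attracted_ex[OF BA] by blast
    then have at: "attracted F B p" using attractors_eq[OF A(1) BA A(2)] by blast
    \<comment> \<open>A source of \<open>B\<close> would be the common attractor \<open>n\<close> of
      the inverses, but \<open>n\<close> lies outside \<open>\<Union>\<B>\<close>.\<close>
    have "\<not> source_sink F B B' m p" for B' m
    proof
      assume ss: "source_sink F B B' m p"
      have B': "B' \<in> \<A>" using source_sink_target_mem[OF ss BA] .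
      obtain q where q: "attracted H B' q" using bwd.attracted_ex[OF B'] by blast
      then have "q = n" using bwd.attractors_eq[OF A(1) B' A(3)] by blast
      then have "m = n" using source_eq_back_attractor[OF ss BA q] by simp
      then show False using ss nS B by (auto simp: source_sink_def)
    qed
    then show ?thesis using at by (simp add: attracted_def)
  qed
  \<comment> \<open>\<open>a\<close> marks the side of \<open>n\<close>: its preimages
    \<open>H i a\<close> tend to \<open>n\<close>, while \<open>a\<close> itself keeps a fixed
    distance from \<open>p\<close>.\<close>
  obtain a where a: "a \<in> A" "a \<noteq> p" "(\<lambda>i. H i a) \<longlonglongrightarrow> n"
    using back_tendsto_obtain[OF A(1,3)] by blast
  have aX: "a \<in> X" using a(1) mem_subset[OF A(1)] by blast
  \<comment> \<open>Small enough that \<open>a\<close>, as well as every point outside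
    \<open>ball p e\<close>, lies outside \<open>ball p e'\<close>.\<close>
  define e' where "e' = min e (dist p a)"
  have e': "e' > 0" using \<open>e > 0\<close> a(2) by (simp add: e'_def)
  obtain d where d: "d > 0" "\<And>S x y. S \<subseteq> ball p d \<Longrightarrow> x \<in> X - ball p e'
      \<Longrightarrow> y \<in> X - ball p e' \<Longrightarrow> connected_component (X - S) x y"
    using small_set_not_separating[OF compact_X locally_connected_X no_cut_points_X pX e'] by blast
  obtain r where r: "r > 0" "\<And>y. y \<in> X \<Longrightarrow> dist y x < r \<Longrightarrow> connected_component (X - \<Union>\<B>) x y"
    using component_near_point[OF locally_connected_X cl xS] by blast
  obtain t where t: "t > 0" "\<And>y. y \<in> X \<Longrightarrow> dist y n < t \<Longrightarrow> connected_component (X - \<Union>\<B>) n y"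
    using component_near_point[OF locally_connected_X cl nS] by blast
  have "\<forall>\<^sub>F i in sequentially. \<forall>B\<in>\<B>. F i ` B \<subseteq> ball p d"
    using \<B>(2) sh d(1) by (intro eventually_ball_finite) (auto simp: shrinks_def)
  moreover have "\<forall>\<^sub>F i in sequentially. dist (H i a) n < t"
    using a(3) t(1) by (rule tendstoD)
  ultimately have "\<forall>\<^sub>F i in sequentially. F i ` (X \<inter> ball x r) \<subseteq> ball p e"
  proof eventually_elim
    case (elim i)
    have "F i y \<in> ball p e" if y: "y \<in> X" "dist y x < r" for y
    proof (rule ccontr)
      assume "F i y \<notin> ball p e"
      then have "F i y \<in> X - ball p e'" using F_in_X[OF y(1)] by (auto simp: e'_def)
      moreover have "a \<in> X - ball p e'" using aX by (simp add: e'_def)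
      moreover have "F i ` \<Union>\<B> \<subseteq> ball p d" using elim(1) by blast
      ultimately have "connected_component (X - F i ` \<Union>\<B>) (F i y) (F i (H i a))"
        using d(2) F_H[OF aX] by simp
      moreover have HaX: "H i a \<in> X" using bwd.F_in_X[OF aX] .
      moreover have "\<Union>\<B> \<subseteq> X" using \<B>(1) mem_subset by blast
      ultimately have "connected_component (X - \<Union>\<B>) y (H i a)"
        using homeomorphism_connected_component[OF homeo] y(1) by blast
      moreover have "connected_component (X - \<Union>\<B>) n (H i a)" using t(2) HaX elim(2) by blast
      moreover have "connected_component (X - \<Union>\<B>) x y" using r(2) y by blast
      ultimately show False
        using xn by (meson connected_component_sym connected_component_trans)
    qed
    then show ?case by (auto simp: dist_commute)
  qed
  then show ?thesis using r(1) by blast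
qed

lemma shrinks_away_from_back_attractor:
  assumes A: "A \<in> \<A>" "attracted F A p" "attracted H A n"
    and C: "compact C" "C \<subseteq> X" "n \<notin> C"
  shows "shrinks F C p"
  unfolding shrinks_def
proof (intro allI impI)
  fix e :: real assume "e > 0"
  have "\<forall>x\<in>C. \<exists>r>0. \<forall>\<^sub>F i in sequentially. F i ` (X \<inter> ball x r) \<subseteq> ball p e"
    using local_collapse[OF A _ _ \<open>e > 0\<close>] C by blast
  then obtain r where r: "\<And>x. x \<in> C \<Longrightarrow> r x > 0"
    "\<And>x. x \<in> C \<Longrightarrow> \<forall>\<^sub>F i in sequentially. F i ` (X \<inter> ball x (r x)) \<subseteq> ball p e"
    by metis
  have cover: "C \<subseteq> (\<Union>x\<in>C. ball x (r x))" using r(1) by force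
  obtain C' where C': "C' \<subseteq> C" "finite C'" "C \<subseteq> (\<Union>x\<in>C'. ball x (r x))"
    by (rule compactE_image[OF C(1) _ cover]) auto
  have "\<forall>\<^sub>F i in sequentially. \<forall>x\<in>C'. F i ` (X \<inter> ball x (r x)) \<subseteq> ball p e"
    using C'(1,2) r(2) by (intro eventually_ball_finite) auto
  then show "\<forall>\<^sub>F i in sequentially. F i ` C \<subseteq> ball p e"
  proof eventually_elim
    case (elim i)
    show ?case
    proof
      fix z assume "z \<in> F i ` C"
      then obtain y where y: "y \<in> C" "z = F i y" by blast
      then obtain x where "x \<in> C'" "y \<in> ball x (r x)" using C'(3) by blast
      then show "z \<in> ball p e" using elim y C(2) by blast
    qed
  qed
qed

end

section \<open>Extracting a subsequence\<close>

text \<open>Either some set occurs infinitely often among the images of \<open>A\<close>, and its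
  stabilizer supplies the dynamics, or each occurs finitely often, and nullness forces the diameters
  to 0.\<close>

lemma attracted_subseq_exists:
  fixes X :: "'a::metric_space set" and f :: "nat \<Rightarrow> 'g"
  assumes act: "homeo_action G X \<phi>" and "compact X"
    and mem: "\<And>A. A \<in> \<A> \<Longrightarrow> closed A \<and> A \<subseteq> X"
    and inv: "\<And>g A. g \<in> carrier G \<Longrightarrow> A \<in> \<A> \<Longrightarrow> \<phi> g ` A \<in> \<A>"
    and null: "\<And>e. e > 0 \<Longrightarrow> finite {A \<in> \<A>. diameter A > e}"
    and conv: "\<And>A. A \<in> \<A> \<Longrightarrow> convergence_group \<phi> (stab G \<phi> A) A"
    and f: "\<And>i. f i \<in> carrier G" "inj f" and A: "A \<in> \<A>" "A \<noteq> {}"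
  shows "\<exists>r p. strict_mono r \<and> attracted (\<lambda>i. \<phi> (f (r i))) A p"
proof -
  interpret group G using act by (simp add: homeo_action_def)
  have homeo: "homeomorphism X X (\<phi> g) (\<phi> (inv\<^bsub>G\<^esub> g))" if "g \<in> carrier G" for g
    using act that by (simp add: homeo_action_def)
  have mult: "\<phi> (g \<otimes>\<^bsub>G\<^esub> h) x = \<phi> g (\<phi> h x)" if "g \<in> carrier G" "h \<in> carrier G" "x \<in> X" for g h x
    using act that by (simp add: homeo_action_def)
  have AX: "A \<subseteq> X" using mem A(1) by blast
  show ?thesis
  proof (cases "\<exists>A'. infinite {i. \<phi> (f i) ` A = A'}")
    case True
    then obtain A' where "infinite {i. \<phi> (f i) ` A = A'}" by blast
    from infinite_enumerate[OF this] obtain r :: "nat \<Rightarrow> nat"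
      where r: "strict_mono r" "\<And>i. \<phi> (f (r i)) ` A = A'" by auto
    have A': "A' \<in> \<A>" using inv[OF f(1)[of "r 0"] A(1)] r(2) by simp
    \<comment> \<open>Composing with the inverse of one fixed \<open>g\<close> turns maps from
      \<open>A\<close> onto \<open>A'\<close> into elements of the stabilizer of
      \<open>A'\<close>.\<close>
    define g where "g = f (r 0)"
    define h where "h i = f (r i) \<otimes>\<^bsub>G\<^esub> inv\<^bsub>G\<^esub> g" for i
    have g: "g \<in> carrier G" "inv\<^bsub>G\<^esub> g \<in> carrier G" using f(1) by (simp_all add: g_def)
    have ginv: "\<phi> (inv\<^bsub>G\<^esub> g) (\<phi> g x) = x" if "x \<in> X" for x
      using homeo[OF g(1)] that by (auto simp: homeomorphism_def)
    have gA: "\<phi> g ` A = A'" using r(2) by (simp add: g_def)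
    have hg: "\<phi> (h i) (\<phi> g x) = \<phi> (f (r i)) x" if "x \<in> X" for i x
    proof -
      have "\<phi> g x \<in> X" using homeo[OF g(1)] that by (auto simp: homeomorphism_def)
      then show ?thesis using mult[OF f(1) g(2)] ginv[OF that] by (simp add: h_def)
    qed
    have "\<phi> (h i) ` A' = A'" for i
    proof -
      have "\<phi> (h i) ` A' = (\<lambda>x. \<phi> (h i) (\<phi> g x)) ` A" using gA by (metis image_image)
      also have "\<dots> = \<phi> (f (r i)) ` A" using hg AX by (intro image_cong) auto
      finally show ?thesis using r(2) by simp
    qed
    then have "\<forall>i. h i \<in> stab G \<phi> A'" using f(1) g(2) by (simp add: stab_def h_def)
    moreover have "inj h"
    proof (rule injI)
      fix i j assume "h i = h j"
      then have "f (r i) = f (r j)" using f(1) g(2) by (simp add: h_def)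
      then show "i = j" using f(2) r(1) by (metis injD strict_mono_eq)
    qed
    ultimately obtain t where t: "strict_mono t" "convergence_seq \<phi> A' (h \<circ> t)"
      using conv[OF A'] unfolding convergence_group_def by blast
    from t(2)[unfolded convergence_seq_def] obtain n' p where np: "n' \<in> A'" "p \<in> A'"
      and cs: "\<forall>C. compact C \<and> C \<subseteq> A' \<and> n' \<notin> C \<longrightarrow> (\<forall>U. openin (top_of_set A') U \<and> p \<in> U \<longrightarrow>
        (\<forall>\<^sub>F i in sequentially. \<phi> ((h \<circ> t) i) ` C \<subseteq> U))"
      by auto
    \<comment> \<open>The repeller found on \<open>A'\<close> is pulled back along \<open>g\<close>
      to become the source in \<open>A\<close>.\<close>
    obtain n where n: "n \<in> A" "n' = \<phi> g n" using np(1) gA by blast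
    have "source_sink (\<lambda>i. \<phi> (f (r (t i)))) A A' n p"
      unfolding source_sink_def shrinks_def
    proof (intro conjI allI impI)
      fix C and e :: real assume C: "compact C \<and> C \<subseteq> A - {n}" and "e > 0"
      have CX: "C \<subseteq> X" using C AX by blast
      have "compact (\<phi> g ` C)"
        using C CX homeo[OF g(1)] by (meson compact_continuous_image continuous_on_subset homeomorphism_def)
      moreover have "\<phi> g ` C \<subseteq> A'" using C gA by blast
      moreover have "n' \<notin> \<phi> g ` C"
      proof
        assume "n' \<in> \<phi> g ` C"
        then obtain y where y: "n' = \<phi> g y" "y \<in> C" by (rule imageE)
        have "n \<in> X" "y \<in> X" using n(1) y(2) AX CX by auto
        then have "n = y" using ginv[of n] ginv[of y] trans[OF n(2)[symmetric] y(1)] by metis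
        then show False using C y(2) by auto
      qed
      moreover have "openin (top_of_set A') (A' \<inter> ball p e)" by (simp add: openin_open_Int)
      moreover have "p \<in> A' \<inter> ball p e" using np \<open>e > 0\<close> by simp
      ultimately have "\<forall>\<^sub>F i in sequentially. \<phi> ((h \<circ> t) i) ` \<phi> g ` C \<subseteq> A' \<inter> ball p e"
        using cs[rule_format, of "\<phi> g ` C" "A' \<inter> ball p e"] by blast
      then show "\<forall>\<^sub>F i in sequentially. \<phi> (f (r (t i))) ` C \<subseteq> ball p e"
      proof eventually_elim
        case (elim i)
        show ?case
        proof
          fix z assume "z \<in> \<phi> (f (r (t i))) ` C"
          then obtain y where y: "z = \<phi> (f (r (t i))) y" "y \<in> C" by (rule imageE)
          then have "z = \<phi> ((h \<circ> t) i) (\<phi> g y)" using hg[of y "t i"] CX by auto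
          then have "z \<in> \<phi> ((h \<circ> t) i) ` \<phi> g ` C" using y(2) by blast
          then show "z \<in> ball p e" using elim by blast
        qed
      qed
    qed (use n np r in auto)
    moreover have "strict_mono (r \<circ> t)" using r(1) t(1) by (rule strict_mono_o)
    ultimately show ?thesis
      unfolding attracted_def by (intro exI[of _ "r \<circ> t"] exI[of _ p]) auto
  next
    case False
    \<comment> \<open>Convergence of a single orbit along a subsequence suffices, because the images
      contract around it.\<close>
    obtain a where a: "a \<in> A" using A(2) by blast
    have "\<phi> (f i) ` X = X" for i
      using homeo[OF f(1)] by (simp add: homeomorphism_def)
    then have "\<forall>i. \<phi> (f i) a \<in> X" using a AX by blast
    then obtain p and r :: "nat \<Rightarrow> nat" where "strict_mono r" "((\<lambda>i. \<phi> (f i) a) \<circ> r) \<longlonglongrightarrow> p"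
      using \<open>compact X\<close>[unfolded compact_def, rule_format, of "\<lambda>i. \<phi> (f i) a"] by auto
    then have r: "strict_mono r" "(\<lambda>i. \<phi> (f (r i)) a) \<longlonglongrightarrow> p" by (simp_all add: o_def)
    have "shrinks (\<lambda>i. \<phi> (f (r i))) A p"
      unfolding shrinks_def
    proof (intro allI impI)
      fix e :: real assume "e > 0"
      \<comment> \<open>\<open>\<D>\<close> is finite, and each of its members is the image for only
        finitely many \<open>i\<close>. Half of \<open>e\<close> is spent on the diameter, half on
        the distance from the limit.\<close>
      define \<D> where "\<D> = {B \<in> \<A>. diameter B > e / 2}"
      have "finite \<D>" using null[of "e / 2"] \<open>e > 0\<close> by (simp add: \<D>_def)
      moreover have "{i. \<phi> (f i) ` A \<in> \<D>} = (\<Union>B\<in>\<D>. {i. \<phi> (f i) ` A = B})" by blast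
      ultimately have "finite {i. \<phi> (f i) ` A \<in> \<D>}" using False by auto
      then have "\<forall>\<^sub>F i in sequentially. \<phi> (f i) ` A \<notin> \<D>"
        by (simp add: eventually_cofinite flip: cofinite_eq_sequentially)
      then have "\<forall>\<^sub>F i in sequentially. \<phi> (f (r i)) ` A \<notin> \<D>"
        by (rule eventually_subseq[OF r(1)])
      moreover have "\<forall>\<^sub>F i in sequentially. dist (\<phi> (f (r i)) a) p < e / 2"
        using r(2) \<open>e > 0\<close> by (intro tendstoD) auto
      ultimately show "\<forall>\<^sub>F i in sequentially. \<phi> (f (r i)) ` A \<subseteq> ball p e"
      proof eventually_elim
        case (elim i)
        have B: "\<phi> (f (r i)) ` A \<in> \<A>" using inv f(1) A(1) by blast
        then have diam: "diameter (\<phi> (f (r i)) ` A) \<le> e / 2" using elim(1) by (auto simp: \<D>_def)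
        have bdd: "bounded (\<phi> (f (r i)) ` A)"
          using mem[OF B] compact_imp_bounded[OF \<open>compact X\<close>] bounded_subset by blast
        show ?case
        proof
          fix z assume z: "z \<in> \<phi> (f (r i)) ` A"
          have "dist (\<phi> (f (r i)) a) z \<le> e / 2"
            using diameter_bounded_bound[OF bdd _ z, of "\<phi> (f (r i)) a"] a diam by auto
          then show "z \<in> ball p e"
            using elim(2) dist_triangle[of p z "\<phi> (f (r i)) a"] by (simp add: dist_commute)
        qed
      qed
    qed
    then show ?thesis using r(1) unfolding attracted_def by blast
  qed
qed

section \<open>Diagonal argument over a countable family\<close>

text \<open>\<open>S\<close> is enumerated and the sequence refined once per index. The diagonal
  sequence refines stage \<open>k\<close> only after an initial segment, hence the hypothesis
  \<open>shift\<close>.\<close>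

lemma diagonal_subsequence:
  fixes P :: "'b \<Rightarrow> (nat \<Rightarrow> nat) \<Rightarrow> bool"
  assumes "countable S" "S \<noteq> {}"
    and sub: "\<And>A s t. A \<in> S \<Longrightarrow> strict_mono (t :: nat \<Rightarrow> nat) \<Longrightarrow> P A s \<Longrightarrow> P A (s \<circ> t)"
    and shift: "\<And>A s k. A \<in> S \<Longrightarrow> P A (\<lambda>i. s (i + k)) \<Longrightarrow> P A s"
    and ex: "\<And>A s. A \<in> S \<Longrightarrow> strict_mono (s :: nat \<Rightarrow> nat) \<Longrightarrow> \<exists>t. strict_mono t \<and> P A (s \<circ> t)"
  obtains s where "strict_mono s" "\<And>A. A \<in> S \<Longrightarrow> P A s"
proof -
  have mem: "from_nat_into S k \<in> S" for k using assms(2) by (rule from_nat_into)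
  interpret subseqs "\<lambda>k. P (from_nat_into S k)"
    by unfold_locales (rule ex[OF mem])
  show ?thesis
  proof (rule that[OF subseq_diagseq])
    fix A assume "A \<in> S"
    then obtain k where k: "from_nat_into S k = A" using from_nat_into_surj[OF assms(1)] by blast
    have "P A (diagseq \<circ> (+) (Suc k))"
      using diagseq_holds[of k] sub[OF mem] unfolding k by blast
    then have "P A (\<lambda>i. diagseq (i + Suc k))" by (simp add: o_def add.commute)
    then show "P A diagseq" by (rule shift[OF \<open>A \<in> S\<close>])
  qed
qed

lemma countable_if_null:
  assumes "\<And>e::real. e > 0 \<Longrightarrow> finite {A \<in> \<A>. diameter A > e}"
    and "\<And>A. A \<in> \<A> \<Longrightarrow> diameter A > 0"
  shows "countable \<A>"
proof -
  have "\<A> \<subseteq> (\<Union>k::nat. {A \<in> \<A>. diameter A > inverse (Suc k)})"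
    using assms(2) reals_Archimedean by blast
  moreover have "countable (\<Union>k::nat. {A \<in> \<A>. diameter A > inverse (Suc k)})"
    using assms(1) by (intro countable_UN) (auto intro: countable_finite)
  ultimately show ?thesis using countable_subset by blast
qed

section \<open>Convergence dynamics on the whole space\<close>

theorem theorem4p10:
  fixes X :: "'a::metric_space set"
    and G :: "('g, 'b) monoid_scheme"
    and \<phi> :: "'g \<Rightarrow> 'a \<Rightarrow> 'a"
    and \<A> :: "'a set set"
  assumes "peano_continuum X"
    and "no_cut_points X"
    and "homeo_action G X \<phi>"
    and "\<forall>A\<in>\<A>. closed A \<and> A \<subseteq> X"
    and "\<forall>g\<in>carrier G. \<forall>A\<in>\<A>. \<phi> g ` A \<in> \<A>"
    and "local_convergence_pairing G \<phi> \<A> X"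
  shows "convergence_group \<phi> (carrier G) X"
proof -
  note X = assms(1)[unfolded peano_continuum_def]
  have card: "\<forall>A\<in>\<A>. infinite A \<or> card A > 2"
    and null: "\<forall>e>0. finite {A \<in> \<A>. diameter A > e}"
    and fine: "\<forall>x\<in>X. \<forall>y\<in>X. x \<noteq> y \<longrightarrow> (\<exists>\<B>. \<B> \<subseteq> \<A> \<and> finite \<B> \<and> separates X (\<Union>\<B>) {x} {y})"
    and conv: "\<forall>A\<in>\<A>. convergence_group \<phi> (stab G \<phi> A) A"
    and crossing: "\<forall>A\<in>\<A>. \<forall>B\<in>\<A>. finite (A \<inter> B) \<and> card (A \<inter> B) \<le> 2 \<longrightarrow>
        (\<forall>c. A \<inter> B = {c} \<longrightarrow> (\<forall>b\<in>B - {c}. crossing_seq_avoiding X \<A> {b, c} A B)) \<and>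
        (card (A \<inter> B) \<noteq> 1 \<longrightarrow> crossing_seq_avoiding X \<A> (A \<inter> B) A B)"
    using assms(6) unfolding local_convergence_pairing_def by - (elim conjE, assumption)+
  interpret G: group G using assms(3) by (simp add: homeo_action_def)
  have homeo: "homeomorphism X X (\<phi> g) (\<phi> (inv\<^bsub>G\<^esub> g))" if "g \<in> carrier G" for g
    using assms(3) that by (simp add: homeo_action_def)
  interpret crossing_family X \<A>
  proof
    show "compact X" "locally connected X" "no_cut_points X" using X assms(2) by auto
    show "closed A" "A \<subseteq> X" if "A \<in> \<A>" for A using assms(4) that by auto
    show "infinite A \<or> card A > 2" if "A \<in> \<A>" for A using card that by blast
    show "crossing_seq_avoiding X \<A> {b, c} A B"
      if "A \<in> \<A>" "B \<in> \<A>" "A \<inter> B = {c}" "b \<in> B - {c}" for A B b c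
      using crossing[THEN bspec, OF that(1), THEN bspec, OF that(2)] that(3,4) by simp
    show "crossing_seq_avoiding X \<A> (A \<inter> B) A B"
      if "A \<in> \<A>" "B \<in> \<A>" "finite (A \<inter> B)" "card (A \<inter> B) \<le> 2" "card (A \<inter> B) \<noteq> 1" for A B
      using crossing[THEN bspec, OF that(1), THEN bspec, OF that(2)] that(3-5) by simp
  qed
  show ?thesis
    unfolding convergence_group_def
  proof (intro allI impI)
    fix f :: "nat \<Rightarrow> 'g" assume f: "(\<forall>i. f i \<in> carrier G) \<and> inj f"
    show "\<exists>r. strict_mono r \<and> convergence_seq \<phi> X (f \<circ> r)"
    proof (cases "\<A> = {}")
      case True
      \<comment> \<open>Without members, fineness would let the empty set separate distinct points
        of the connected set \<open>X\<close>. So \<open>X\<close> is a single point, and a subset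
        missing it is empty.\<close>
      have eq: "x = y" if xy: "x \<in> X" "y \<in> X" for x y
      proof (rule ccontr)
        assume "x \<noteq> y"
        from fine[rule_format, OF xy this] have "separates X {} {x} {y}" using True by auto
        moreover have "connected_component X x y"
          using X xy unfolding connected_component_def by blast
        ultimately show False by (simp add: separates_def)
      qed
      obtain x where x: "x \<in> X" using X by blast
      have "C = {}" if "C \<subseteq> X" "x \<notin> C" for C using that eq x by blast
      then have "\<phi> ((f \<circ> id) i) ` C \<subseteq> U" if "compact C \<and> C \<subseteq> X \<and> x \<notin> C" for C U i
        using that by (metis empty_subsetI image_empty)
      then have "convergence_seq \<phi> X (f \<circ> id)"
        unfolding convergence_seq_def using x by (intro bexI[of _ x] allI impI always_eventually) simp_all
      then show ?thesis using strict_mono_id by blast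
    next
      case False
      \<comment> \<open>Forward and inverse attraction are bundled so that one diagonal argument
        secures both.\<close>
      define P where "P A s \<longleftrightarrow> (\<exists>p. attracted (\<lambda>i. \<phi> (f (s i))) A p) \<and>
        (\<exists>p. attracted (\<lambda>i. \<phi> (inv\<^bsub>G\<^esub> (f (s i)))) A p)" for A and s :: "nat \<Rightarrow> nat"
      have diam: "diameter A > 0" if A: "A \<in> \<A>" for A
      proof -
        obtain a where a: "a \<in> A" using mem_obtain_avoiding[OF A] by blast
        obtain b where b: "b \<in> A" "b \<noteq> a" using mem_obtain_avoiding[OF A] by blast
        have "dist a b \<le> diameter A"
          using diameter_bounded_bound[OF compact_imp_bounded[OF compact_mem[OF A]] a b(1)] .
        moreover have "dist a b > 0" using b(2) by simp
        ultimately show ?thesis by linarith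
      qed
      have sub: "P A (s \<circ> t)" if "strict_mono t" "P A s" for A s and t :: "nat \<Rightarrow> nat"
        using that attracted_subseq[of "\<lambda>i. \<phi> (f (s i))" A _ t]
          attracted_subseq[of "\<lambda>i. \<phi> (inv\<^bsub>G\<^esub> (f (s i)))" A _ t]
        unfolding P_def o_def by blast
      have shift: "P A s" if "P A (\<lambda>i. s (i + k))" for A s k
        using that attracted_shift[of "\<lambda>i. \<phi> (f (s i))" k A]
          attracted_shift[of "\<lambda>i. \<phi> (inv\<^bsub>G\<^esub> (f (s i)))" k A]
        unfolding P_def by blast
      \<comment> \<open>A subsequence is chosen for \<open>f\<close>, then a further one for the
        inverses; attraction under \<open>f\<close> survives the second choice.\<close>
      have ex: "\<exists>t. strict_mono t \<and> P A (s \<circ> t)" if A: "A \<in> \<A>" and s: "strict_mono s" for A and s :: "nat \<Rightarrow> nat"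
      proof -
        have nonempty: "A \<noteq> {}" using mem_obtain_avoiding[OF A] by blast
        have step: "\<exists>r p. strict_mono r \<and> attracted (\<lambda>i. \<phi> (h (r i))) A p"
          if "\<And>i. h i \<in> carrier G" "inj h" for h :: "nat \<Rightarrow> 'g"
          by (rule attracted_subseq_exists[OF assms(3) compact_X _ _ null[rule_format] conv[rule_format] that A nonempty])
            (use assms(4,5) in auto)
        have fs: "i = j" if "f (s i) = f (s j)" for i j
          using injD[OF conjunct2[OF f] that] strict_mono_eq[OF s] by blast
        then have "inj (\<lambda>i. f (s i))" by (rule injI)
        then obtain r p where r: "strict_mono r" "attracted (\<lambda>i. \<phi> (f (s (r i)))) A p"
          using step[of "\<lambda>i. f (s i)"] f by blast
        have "inj (\<lambda>i. inv\<^bsub>G\<^esub> (f (s (r i))))"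
        proof (rule injI)
          fix i j assume "inv\<^bsub>G\<^esub> (f (s (r i))) = inv\<^bsub>G\<^esub> (f (s (r j)))"
          then have "inv\<^bsub>G\<^esub> (inv\<^bsub>G\<^esub> (f (s (r i)))) = inv\<^bsub>G\<^esub> (inv\<^bsub>G\<^esub> (f (s (r j))))"
            by (rule arg_cong)
          then have "f (s (r i)) = f (s (r j))" using f by simp
          then show "i = j" using fs strict_mono_eq[OF r(1)] by blast
        qed
        then obtain t q where t: "strict_mono t" "attracted (\<lambda>i. \<phi> (inv\<^bsub>G\<^esub> (f (s (r (t i)))))) A q"
          using step[of "\<lambda>i. inv\<^bsub>G\<^esub> (f (s (r i)))"] f by auto
        have "attracted (\<lambda>i. \<phi> (f (s (r (t i))))) A p"
          using attracted_subseq[OF r(2) t(1)] by (simp add: o_def)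
        then have "P A (s \<circ> (r \<circ> t))" using t(2) unfolding P_def o_def by blast
        then show ?thesis using strict_mono_o[OF r(1) t(1)] by blast
      qed
      have "countable \<A>" using null diam by (intro countable_if_null) auto
      then obtain s where s: "strict_mono s" "\<And>A. A \<in> \<A> \<Longrightarrow> P A s"
        by (rule diagonal_subsequence[of "\<A>" P]) (use False in \<open>blast intro: sub shift ex\<close>)+
      define F where "F i = \<phi> (f (s i))" for i
      define H where "H i = \<phi> (inv\<^bsub>G\<^esub> (f (s i)))" for i
      have attr: "(\<exists>p. attracted F A p) \<and> (\<exists>p. attracted H A p)" if "A \<in> \<A>" for A
        using s(2)[OF that] unfolding P_def F_def H_def .
      interpret two_sided_dynamics X \<A> F H
      proof
        fix i
        show FH: "homeomorphism X X (F i) (H i)" using homeo f by (simp add: F_def H_def)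
        show "homeomorphism X X (H i) (F i)" using FH homeomorphism_symD by blast
        show "F i ` A \<in> \<A>" "H i ` A \<in> \<A>" if "A \<in> \<A>" for A
          using that assms(5) f by (simp_all add: F_def H_def)
      qed (use attr fine in blast)+
      obtain A where A: "A \<in> \<A>" using False by blast
      obtain p n where pn: "attracted F A p" "attracted H A n" using attr[OF A] by blast
      \<comment> \<open>The repeller is the attractor \<open>n\<close> of the inverses.\<close>
      have "convergence_seq \<phi> X (f \<circ> s)"
        unfolding convergence_seq_def
      proof (rule bexI[of _ n], rule bexI[of _ p], intro allI impI)
        fix C U
        assume C: "compact C \<and> C \<subseteq> X \<and> n \<notin> C" and U: "openin (top_of_set X) U \<and> p \<in> U"
        obtain e where e: "e > 0" "ball p e \<inter> X \<subseteq> U"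
          using U openin_contains_ball by metis
        have "shrinks F C p"
          using shrinks_away_from_back_attractor[OF A pn] C by blast
        then have "\<forall>\<^sub>F i in sequentially. F i ` C \<subseteq> ball p e"
          using e(1) by (simp add: shrinks_def)
        then show "\<forall>\<^sub>F i in sequentially. \<phi> ((f \<circ> s) i) ` C \<subseteq> U"
        proof eventually_elim
          case (elim i)
          moreover have "F i ` C \<subseteq> X" using C F_in_X by blast
          ultimately show ?case using e(2) unfolding F_def by auto
        qed
      qed (use pn A attractor_in_X bwd.attractor_in_X in blast)+
      then show ?thesis using s(1) by blast
    qed
  qed
qed

end
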